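(* Let $\lambda_1(n),\lambda_2(n),\lambda_3(n)$ be the normalised Fourier coefficients of forms $f_1,f_2,f_3$, each of which is either a primitive holomorphic Hecke eigen cusp form or a primitive Hecke–Maass cusp form for the full modular group $SL(2,\mathbb{Z})$. Let $V$ and $W$ be smooth bump functions supported on the interval $[1,2]$. Let $\epsilon>0$ and assume $H \gg N^{1/2+\epsilon}$. Then there exists a positive constant $\delta=\delta(\epsilon)$ such that \[ \frac{1}{H}\sum_{h\leq H} V\!\left(\frac{h}{H}\right)\sum_{n\leq N}\lambda_1(n)\lambda_2(n+h)\lambda_3(n+2h)\,W\!\left(\frac{n}{N}\right) \ll N^{1-\delta}. \]
   Context: For a primitive holomorphic Hecke eigenform $f$ of integral weight $k$ on $SL(2,\mathbb{Z})$, the normalised Fourier expansion at $\infty$ is $f(z)=\sum_{n\ge1}\lambda_f(n)n^{(k-1)/2}e(nz)$ with $\lambda_f(1)=1$, where $e(z)=e^{2\pi i z}$. For a primitive Maass cusp form $f$ on $SL(2,\mathbb{Z})$ with Laplace eigenvalue $\tfrac14+\nu^2$, the normalised Fourier expansion is $f(x+iy)=\sqrt{y}\sum_{n\neq0}\lambda_f(n)K_{i\nu}(2\pi|n|y)e(nx)$ with $\lambda_f(1)=1$, where $K_{i\nu}$ is the $K$-Bessel function. The implied constants may depend on $\epsilon$, the forms $f_i$, and $V,W$. *)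

theory Defs
  imports "HOL-Complex_Analysis.Complex_Analysis"
begin

definition upper_half_plane :: "complex set" where
  "upper_half_plane = {z. Im z > 0}"

definition fourier_e :: "complex \<Rightarrow> complex" where
  "fourier_e z = exp (2 * of_real pi * \<i> * z)"

definition modular_of_weight :: "int \<Rightarrow> (complex \<Rightarrow> complex) \<Rightarrow> bool" where
  "modular_of_weight k f \<longleftrightarrow>
     (\<forall>a b c d :: int. a * d - b * c = 1 \<longrightarrow>
       (\<forall>z \<in> upper_half_plane.
          f ((of_int a * z + of_int b) / (of_int c * z + of_int d)) =
            (of_int c * z + of_int d) powi k * f z))"

text \<open>
  Hecke operators for the full modular group in weight \<open>k\<close>. The sum runs over the factorisations
  \<open>n = a * d\<close> with \<open>a = n div d\<close>. The normalisation is the one for which the eigenvalue of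
  \<open>T\<^sub>n\<close> on a primitive form is the normalised Fourier coefficient at \<open>n\<close>, both for holomorphic forms (where it is
  \<open>n powr (- (k-1)/2)\<close> times the classical operator) and for Maass forms (\<open>k = 0\<close>).
\<close>
definition hecke_operator ::
    "int \<Rightarrow> nat \<Rightarrow> (complex \<Rightarrow> complex) \<Rightarrow> complex \<Rightarrow> complex" where
  "hecke_operator k n f z =
     1 / of_real (sqrt (real n)) *
     (\<Sum>d | d dvd n.
        of_real ((real (n div d) / real d) powr (real_of_int k / 2)) *
        (\<Sum>b<d. f ((of_nat (n div d) * z + of_nat b) / of_nat d)))"

definition hecke_eigenfunction :: "int \<Rightarrow> (complex \<Rightarrow> complex) \<Rightarrow> bool" where
  "hecke_eigenfunction k f \<longleftrightarrow>
     (\<forall>n\<ge>1. \<exists>\<mu>. \<forall>z \<in> upper_half_plane. hecke_operator k n f z = \<mu> * f z)"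


definition holomorphic_cusp_form :: "int \<Rightarrow> (complex \<Rightarrow> complex) \<Rightarrow> bool" where
  "holomorphic_cusp_form k f \<longleftrightarrow>
     f holomorphic_on upper_half_plane \<and>
     modular_of_weight k f \<and>
     (\<exists>a :: nat \<Rightarrow> complex. \<forall>z \<in> upper_half_plane.
        ((\<lambda>n. a n * fourier_e (of_nat n * z)) has_sum f z) {1..})"

definition holomorphic_coeffs ::
    "int \<Rightarrow> (complex \<Rightarrow> complex) \<Rightarrow> (nat \<Rightarrow> complex) \<Rightarrow> bool" where
  "holomorphic_coeffs k f lam \<longleftrightarrow>
     (\<forall>z \<in> upper_half_plane.
        ((\<lambda>n. lam n * of_real (real n powr ((real_of_int k - 1) / 2)) * fourier_e (of_nat n * z))
           has_sum f z) {1..})"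

text \<open>In level one there are no oldforms, so primitive means Hecke eigenform with first
  coefficient 1. The value of \<open>lam\<close> at 0 is irrelevant.\<close>
definition primitive_holomorphic_form ::
    "int \<Rightarrow> (complex \<Rightarrow> complex) \<Rightarrow> (nat \<Rightarrow> complex) \<Rightarrow> bool" where
  "primitive_holomorphic_form k f lam \<longleftrightarrow>
     holomorphic_cusp_form k f \<and> hecke_eigenfunction k f \<and>
     holomorphic_coeffs k f lam \<and> lam 1 = 1"


text \<open>\<open>bessel_K s y\<close> is \<open>K\<^sub>s(y)\<close> for \<open>y > 0\<close>, via the classical integral representation.\<close>
definition bessel_K :: "complex \<Rightarrow> real \<Rightarrow> complex" where
  "bessel_K s y = integral {0..} (\<lambda>t. of_real (exp (- y * cosh t)) * cosh (s * of_real t))"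

definition dir_deriv :: "complex \<Rightarrow> (complex \<Rightarrow> complex) \<Rightarrow> complex \<Rightarrow> complex" where
  "dir_deriv v f z = vector_derivative (\<lambda>t. f (z + of_real t * v)) (at 0)"

text \<open>Real smoothness on an open set: all iterated partial derivatives (in the directions \<open>1\<close>,
  i.e. \<open>\<partial>/\<partial>x\<close>, and \<open>\<i>\<close>, i.e. \<open>\<partial>/\<partial>y\<close>) are differentiable in the real sense.\<close>
definition real_smooth_on :: "complex set \<Rightarrow> (complex \<Rightarrow> complex) \<Rightarrow> bool" where
  "real_smooth_on S f \<longleftrightarrow>
     (\<forall>vs. set vs \<subseteq> {1, \<i>} \<longrightarrow> foldr dir_deriv vs f differentiable_on S)"

definition hyperbolic_laplacian :: "(complex \<Rightarrow> complex) \<Rightarrow> complex \<Rightarrow> complex" where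
  "hyperbolic_laplacian f z =
     - of_real ((Im z)\<^sup>2) * (dir_deriv 1 (dir_deriv 1 f) z + dir_deriv \<i> (dir_deriv \<i> f) z)"

text \<open>The conjuncts are: smoothness, automorphy, the eigenvalue equation, moderate growth at the
  cusp and vanishing of the zeroth Fourier coefficient. The parameter \<open>\<nu>\<close> is allowed to be complex;
  no a priori lower bound on the eigenvalue is imposed.\<close>
definition maass_cusp_form :: "complex \<Rightarrow> (complex \<Rightarrow> complex) \<Rightarrow> bool" where
  "maass_cusp_form \<nu> f \<longleftrightarrow>
     real_smooth_on upper_half_plane f \<and>
     modular_of_weight 0 f \<and>
     (\<forall>z \<in> upper_half_plane. hyperbolic_laplacian f z = (1 / 4 + \<nu>\<^sup>2) * f z) \<and>
     (\<exists>A B. \<forall>z. Im z \<ge> 1 \<longrightarrow> norm (f z) \<le> B * Im z powr A) \<and>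
     (\<forall>y>0. integral {0..1} (\<lambda>x. f (Complex x y)) = 0)"

definition maass_coeffs ::
    "complex \<Rightarrow> (complex \<Rightarrow> complex) \<Rightarrow> (int \<Rightarrow> complex) \<Rightarrow> bool" where
  "maass_coeffs \<nu> f lam \<longleftrightarrow>
     (\<forall>x. \<forall>y>0.
        ((\<lambda>n. of_real (sqrt y) * lam n * bessel_K (\<i> * \<nu>) (2 * pi * \<bar>real_of_int n\<bar> * y) *
               fourier_e (of_int n * of_real x))
           has_sum f (Complex x y)) (UNIV - {0}))"

definition primitive_maass_form ::
    "complex \<Rightarrow> (complex \<Rightarrow> complex) \<Rightarrow> (int \<Rightarrow> complex) \<Rightarrow> bool" where
  "primitive_maass_form \<nu> f lam \<longleftrightarrow>
     maass_cusp_form \<nu> f \<and> hecke_eigenfunction 0 f \<and>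
     maass_coeffs \<nu> f lam \<and> lam 1 = 1"


text \<open>\<open>lam\<close> gives the normalised Fourier coefficients of positive index of the form \<open>f\<close>.\<close>
definition primitive_form_coeffs :: "(complex \<Rightarrow> complex) \<Rightarrow> (nat \<Rightarrow> complex) \<Rightarrow> bool" where
  "primitive_form_coeffs f lam \<longleftrightarrow>
     (\<exists>k. primitive_holomorphic_form k f lam) \<or>
     (\<exists>\<nu> \<rho>. primitive_maass_form \<nu> f \<rho> \<and> (\<forall>n\<ge>1. lam n = \<rho> (int n)))"


definition smooth_bump :: "real set \<Rightarrow> (real \<Rightarrow> real) \<Rightarrow> bool" where
  "smooth_bump S V \<longleftrightarrow>
     (\<forall>j x. (deriv ^^ j) V differentiable (at x)) \<and> (\<forall>x. x \<notin> S \<longrightarrow> V x = 0)"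

text \<open>A smooth function supported on \<open>[1,2]\<close> vanishes on all of \<open>(-\<infinity>,1]\<close>. Hence in a sum weighted
  by \<open>V (h / H)\<close> a literal cutoff \<open>h \<le> H\<close> would leave no nonzero term; the sums to
  be estimated therefore run over the whole support, \<open>h \<le> 2 * H\<close> and \<open>n \<le> 2 * N\<close>.\<close>
lemma smooth_bump_eq_0:
  assumes "smooth_bump {1..2} V" "x \<le> 1"
  shows "V x = 0"
proof (cases "x < 1")
  case True
  with assms show ?thesis by (simp add: smooth_bump_def)
next
  case False
  with assms(2) have x: "x = 1" by simp
  have "(deriv ^^ 0) V differentiable (at 1)"
    using assms(1) unfolding smooth_bump_def by blast
  then have "isCont V 1"
    by (simp add: differentiable_imp_continuous_within)
  then have "(V \<longlongrightarrow> V 1) (at_left 1)"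
    by (simp add: continuous_within filterlim_at_split)
  moreover have "eventually (\<lambda>y. V y = 0) (at_left 1)"
    using assms(1) by (auto simp: smooth_bump_def eventually_at_filter)
  then have "(V \<longlongrightarrow> 0) (at_left 1)"
    by (rule tendsto_eventually)
  ultimately have "V 1 = 0"
    by (rule tendsto_unique[OF trivial_limit_at_left_real])
  with x show ?thesis by simp
qed

end

(* The whole problem reduces to the uniform bound sum_{n <= X} lam(n) e(n alpha) << X^(1/2) log X
   (Wilton) and to sum_{n <= X} |lam(n)|^2 << X. Both come from the boundedness of y^(k/2) |f(x+iy)|
   on the upper half plane: viewed as a Fourier series in x at height y ~ 1/X, its coefficients are
   lam(n) times a smooth nonvanishing weight for n ~ X, so Parseval gives the mean square and
   convolution with the Dirichlet kernel gives the exponential sums, with a logarithm from the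
   L^1 norm of the kernel.

   For the correlation sum, write m = n + h and l = n + 2h, so that n + l = 2m. Cut the range of n
   into blocks of length about H and separate the weight V((m-n)/H) by summing twice by parts.
   In each block the circle method applies, with Wilton's bound for the sum over n and the mean
   squares of lam2 and lam3. The blocks add up to N^(1/2) log N (N + H), to be divided by H; since H
   appears only through mean squares, no factor H^eps is lost when H is much larger than N.

   All integrals over alpha are replaced by averages over the points r/q, with q larger than every
   frequency involved. *)
theory Submission
  imports Defs
begin

text \<open>Both types of form are brought to one shape, y^(k/2) f(x + i y) = sqrt y * sum \<rho>(n)
  \<kappa>(|n| y) e(n x), with \<kappa>(u) = u^((k-1)/2) exp(-2 pi u) for holomorphic forms and
  \<kappa>(u) = K_{i \<nu>}(2 pi u), k = 0, for Maass forms. Reading off \<rho>(n) means dividing by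
  \<kappa>. Since K_{i \<nu>} may oscillate near 0, the height y is chosen so that n y stays in a
  window [a, 3 a] far enough out, where \<kappa> is bounded below and Lipschitz. In the correlation
  sum the obstacle is that V((m - n)/H) couples n and m. One summation by parts leaves the condition
  m - n > j, which still couples them. The second turns it into a count of integers t with n <= t <
  m - j, and for fixed t and j the conditions on n and m are independent. About H^2 pairs (j, t)
  arise, each with a second difference of V at step 1/H as coefficient; this is O(1/H^2), so the
  separation costs only a constant.\<close>

section \<open>Discrete orthogonality and the circle method\<close>

lemma sum_cis_multiples:
  fixes k :: int and q :: nat
  assumes "q > 0"
  shows "(\<Sum>r<q. cis (2 * pi * (of_int k * (real r / real q)))) = (if int q dvd k then of_nat q else 0)"
proof -
  define z where "z = cis (2 * pi * (of_int k / real q))"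
  have pow: "cis (2 * pi * (of_int k * (real r / real q))) = z ^ r" for r
    unfolding z_def Complex.DeMoivre by (rule arg_cong[of _ _ cis]) simp
  show ?thesis
  proof (cases "int q dvd k")
    case True
    then obtain m where m: "k = int q * m" by (auto simp: dvd_def)
    have "z = 1" using assms by (simp add: z_def m cis_multiple_2pi)
    then show ?thesis using True by (simp only: pow power_one) simp
  next
    case False
    have "z \<noteq> 1"
    proof
      assume "z = 1"
      then have "cos (2 * pi * (of_int k / real q)) = 1"
        by (auto simp: z_def complex_eq_iff)
      then obtain m :: int where "2 * pi * (of_int k / real q) = of_int m * 2 * pi"
        using cos_one_2pi_int by blast
      then have "2 * pi * (of_int k / real q) = 2 * pi * of_int m" by (simp only: mult_ac)
      then have "of_int k / real q = of_int m" by (subst (asm) mult_left_cancel) auto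
      then have "real_of_int k = real_of_int (int q * m)" using assms by (simp add: field_simps)
      then have "k = int q * m" by linarith
      then show False using False by simp
    qed
    moreover have "z ^ q = 1"
    proof -
      have "real q * (2 * pi * (of_int k / real q)) = 2 * pi * of_int k" using assms by simp
      then show ?thesis by (simp only: z_def Complex.DeMoivre) simp
    qed
    ultimately have "(\<Sum>r<q. z ^ r) = 0" by (simp add: geometric_sum)
    then show ?thesis using False by (simp only: pow) simp
  qed
qed

text \<open>After expansion each pair (i, j) carries the frequency \<phi> i - \<psi> j. Being
  smaller than q in absolute value, it is divisible by q only if it is 0, so the average over the
  points r/q agrees exactly with the integral over the circle.\<close>

lemma sum_trig_poly_mult_cnj:
  fixes \<phi> :: "'a \<Rightarrow> int" and \<psi> :: "'b \<Rightarrow> int" and a :: "'a \<Rightarrow> complex" and b :: "'b \<Rightarrow> complex"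
  assumes "q > 0" and sep: "\<And>i j. i \<in> I \<Longrightarrow> j \<in> J \<Longrightarrow> \<bar>\<phi> i - \<psi> j\<bar> < int q"
  shows "(\<Sum>r<q. (\<Sum>i\<in>I. a i * cis (2 * pi * (of_int (\<phi> i) * (real r / real q)))) *
                 cnj (\<Sum>j\<in>J. b j * cis (2 * pi * (of_int (\<psi> j) * (real r / real q)))))
       = of_nat q * (\<Sum>i\<in>I. \<Sum>j\<in>J. if \<phi> i = \<psi> j then a i * cnj (b j) else 0)"
proof -
  have c: "cis (2 * pi * (of_int (\<phi> i) * (real r / real q))) * cis (- (2 * pi * (of_int (\<psi> j) * (real r / real q))))
        = cis (2 * pi * (of_int (\<phi> i - \<psi> j) * (real r / real q)))" for i j r
    by (simp add: cis_mult algebra_simps)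
  have "(\<Sum>r<q. (\<Sum>i\<in>I. a i * cis (2 * pi * (of_int (\<phi> i) * (real r / real q)))) *
                 cnj (\<Sum>j\<in>J. b j * cis (2 * pi * (of_int (\<psi> j) * (real r / real q)))))
     = (\<Sum>r<q. \<Sum>i\<in>I. \<Sum>j\<in>J. a i * cnj (b j) * cis (2 * pi * (of_int (\<phi> i - \<psi> j) * (real r / real q))))"
    unfolding cnj_sum sum_product c[symmetric]
    by (intro sum.cong refl) (simp add: cis_cnj)
  also have "\<dots> = (\<Sum>i\<in>I. \<Sum>r<q. \<Sum>j\<in>J. a i * cnj (b j) * cis (2 * pi * (of_int (\<phi> i - \<psi> j) * (real r / real q))))"
    by (rule sum.swap)
  also have "\<dots> = (\<Sum>i\<in>I. \<Sum>j\<in>J. \<Sum>r<q. a i * cnj (b j) * cis (2 * pi * (of_int (\<phi> i - \<psi> j) * (real r / real q))))"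
    by (intro sum.cong refl sum.swap)
  also have "\<dots> = (\<Sum>i\<in>I. \<Sum>j\<in>J. of_nat q * (if \<phi> i = \<psi> j then a i * cnj (b j) else 0))"
  proof (intro sum.cong refl)
    fix i j assume "i \<in> I" "j \<in> J"
    then have "int q dvd \<phi> i - \<psi> j \<longleftrightarrow> \<phi> i = \<psi> j"
      using sep[of i j] zdvd_not_zless[of "\<bar>\<phi> i - \<psi> j\<bar>" "int q"] by auto
    then show "(\<Sum>r<q. a i * cnj (b j) * cis (2 * pi * (of_int (\<phi> i - \<psi> j) * (real r / real q))))
      = of_nat q * (if \<phi> i = \<psi> j then a i * cnj (b j) else 0)"
      unfolding sum_distrib_left[symmetric] sum_cis_multiples[OF assms(1)] by simp
  qed
  finally show ?thesis by (simp add: sum_distrib_left)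
qed

text \<open>Parseval: injectivity of \<phi> leaves only the diagonal. A general frequency map is
  allowed because in the circle method the index m carries the frequency 2 m.\<close>

lemma sum_norm_trig_poly_square:
  fixes \<phi> :: "'a \<Rightarrow> int" and a :: "'a \<Rightarrow> complex"
  assumes "q > 0" "finite I" "inj_on \<phi> I" and sep: "\<And>i j. i \<in> I \<Longrightarrow> j \<in> I \<Longrightarrow> \<bar>\<phi> i - \<phi> j\<bar> < int q"
  shows "(\<Sum>r<q. (norm (\<Sum>i\<in>I. a i * cis (2 * pi * (of_int (\<phi> i) * (real r / real q)))))\<^sup>2)
       = q * (\<Sum>i\<in>I. (norm (a i))\<^sup>2)"
proof -
  have inner: "(\<Sum>j\<in>I. if \<phi> i = \<phi> j then a i * cnj (a j) else 0) = of_real ((norm (a i))\<^sup>2)" if "i \<in> I" for i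
  proof -
    have "(\<Sum>j\<in>I. if \<phi> i = \<phi> j then a i * cnj (a j) else 0) = (\<Sum>j\<in>I. if i = j then a i * cnj (a j) else 0)"
      using that assms(3) by (intro sum.cong refl) (auto simp: inj_on_def)
    then show ?thesis using that assms(2) by (simp only: sum.delta' complex_norm_square if_True)
  qed
  have "complex_of_real (\<Sum>r<q. (norm (\<Sum>i\<in>I. a i * cis (2 * pi * (of_int (\<phi> i) * (real r / real q)))))\<^sup>2)
     = of_real (q * (\<Sum>i\<in>I. (norm (a i))\<^sup>2))"
    using sum_trig_poly_mult_cnj[of q I I \<phi> \<phi> a a, OF assms(1) sep]
    by (simp only: of_real_sum complex_norm_square[symmetric] of_real_mult of_real_of_nat_eq inner cong: sum.cong)
  then show ?thesis using of_real_eq_iff by blast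
qed

text \<open>The product S1 * S3 * cnj S2 averages to the sum over n + l = 2 m. The factor over n is
  estimated by its supremum, the other two by the arithmetic-geometric mean inequality and Parseval,
  so that no pointwise information on u and v enters.\<close>

lemma circle_method_bound:
  fixes I J L :: "nat set" and b u v :: "nat \<Rightarrow> complex"
  assumes fin: "finite I" "finite J" "finite L"
    and S: "\<And>\<alpha>. norm (\<Sum>n\<in>I. b n * cis (2 * pi * (real n * \<alpha>))) \<le> S"
  shows "norm (\<Sum>n\<in>I. \<Sum>m\<in>J. \<Sum>l\<in>L. if n + l = 2 * m then b n * u m * v l else 0)
     \<le> S / 2 * ((\<Sum>m\<in>J. (norm (u m))\<^sup>2) + (\<Sum>l\<in>L. (norm (v l))\<^sup>2))"
proof -
  obtain Q where Q: "\<forall>n\<in>I \<union> J \<union> L. n \<le> Q"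
    using fin finite_nat_set_iff_bounded_le[of "I \<union> J \<union> L"] by auto
  \<comment> \<open>All of n + l - 2 m, 2 i - 2 j and i - j are at most 2 Q in absolute value, hence
    below q.\<close>
  define q where "q = 4 * Q + 1"
  have q: "q > 0" by (simp add: q_def)
  let ?e = "\<lambda>k r. cis (2 * pi * (of_int k * (real r / real q)))"
  define S1 where "S1 = (\<lambda>r. \<Sum>n\<in>I. b n * ?e (int n) r)"
  \<comment> \<open>The factor enters conjugated, which restores u m and makes the frequency - 2
    m.\<close>
  define S2 where "S2 = (\<lambda>r. \<Sum>m\<in>J. cnj (u m) * ?e (2 * int m) r)"
  define S3 where "S3 = (\<lambda>r. \<Sum>l\<in>L. v l * ?e (int l) r)"
  have iff: "int n + int l = 2 * int m \<longleftrightarrow> n + l = 2 * m" for n l m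
    by linarith
  have S13: "S1 r * S3 r = (\<Sum>p\<in>I\<times>L. b (fst p) * v (snd p) * ?e (int (fst p) + int (snd p)) r)" for r
    unfolding S1_def S3_def sum_product sum.cartesian_product
    by (intro sum.cong refl)
      (auto simp: cis_mult distrib_left distrib_right add_divide_distrib)
  have "(\<Sum>r<q. S1 r * S3 r * cnj (S2 r)) = of_nat q * (\<Sum>p\<in>I\<times>L. \<Sum>m\<in>J.
      if int (fst p) + int (snd p) = 2 * int m then b (fst p) * v (snd p) * cnj (cnj (u m)) else 0)"
    unfolding S13 S2_def
  proof (rule sum_trig_poly_mult_cnj[OF q])
    fix p m assume "p \<in> I \<times> L" "m \<in> J"
    then have "fst p \<le> Q" "snd p \<le> Q" "m \<le> Q" using Q by auto
    then show "\<bar>int (fst p) + int (snd p) - 2 * int m\<bar> < int q" by (simp add: q_def)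
  qed
  also have "(\<Sum>p\<in>I\<times>L. \<Sum>m\<in>J.
      if int (fst p) + int (snd p) = 2 * int m then b (fst p) * v (snd p) * cnj (cnj (u m)) else 0)
     = (\<Sum>n\<in>I. \<Sum>l\<in>L. \<Sum>m\<in>J. if n + l = 2 * m then b n * u m * v l else 0)"
    unfolding sum.cartesian_product'
    by (intro sum.cong refl) (auto simp: iff)
  also have "\<dots> = (\<Sum>n\<in>I. \<Sum>m\<in>J. \<Sum>l\<in>L. if n + l = 2 * m then b n * u m * v l else 0)"
    by (intro sum.cong refl sum.swap)
  finally have eq: "(\<Sum>r<q. S1 r * S3 r * cnj (S2 r)) =
      of_nat q * (\<Sum>n\<in>I. \<Sum>m\<in>J. \<Sum>l\<in>L. if n + l = 2 * m then b n * u m * v l else 0)" .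
  have "real q * norm (\<Sum>n\<in>I. \<Sum>m\<in>J. \<Sum>l\<in>L. if n + l = 2 * m then b n * u m * v l else 0)
     = norm (\<Sum>r<q. S1 r * S3 r * cnj (S2 r))"
    unfolding eq by (simp add: norm_mult)
  also have "\<dots> \<le> (\<Sum>r<q. S / 2 * ((norm (S2 r))\<^sup>2 + (norm (S3 r))\<^sup>2))"
  proof (intro sum_norm_le)
    fix r
    have n1: "norm (S1 r) \<le> S" using S[of "real r / real q"] by (simp add: S1_def)
    have "norm (S1 r * S3 r * cnj (S2 r)) = norm (S1 r) * (norm (S3 r) * norm (S2 r))"
      by (simp add: norm_mult)
    also have "\<dots> \<le> S * (norm (S3 r) * norm (S2 r))" by (intro mult_right_mono n1) auto
    also have "\<dots> \<le> S * (((norm (S2 r))\<^sup>2 + (norm (S3 r))\<^sup>2) / 2)"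
    proof (rule mult_left_mono)
      show "norm (S3 r) * norm (S2 r) \<le> ((norm (S2 r))\<^sup>2 + (norm (S3 r))\<^sup>2) / 2"
        using sum_squares_bound[of "norm (S3 r)" "norm (S2 r)"] by simp
      show "0 \<le> S" using n1 norm_ge_zero[of "S1 r"] by linarith
    qed
    finally show "norm (S1 r * S3 r * cnj (S2 r)) \<le> S / 2 * ((norm (S2 r))\<^sup>2 + (norm (S3 r))\<^sup>2)" by simp
  qed
  also have "\<dots> = S / 2 * ((\<Sum>r<q. (norm (S2 r))\<^sup>2) + (\<Sum>r<q. (norm (S3 r))\<^sup>2))"
    by (simp only: sum_distrib_left[symmetric] sum.distrib)
  also have "(\<Sum>r<q. (norm (S2 r))\<^sup>2) = q * (\<Sum>m\<in>J. (norm (cnj (u m)))\<^sup>2)"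
    unfolding S2_def
  proof (rule sum_norm_trig_poly_square[OF q fin(2)])
    fix i j assume "i \<in> J" "j \<in> J"
    then have "i \<le> Q" "j \<le> Q" using Q by auto
    then show "\<bar>2 * int i - 2 * int j\<bar> < int q" by (simp add: q_def)
  qed (simp add: inj_on_def)
  also have "(\<Sum>r<q. (norm (S3 r))\<^sup>2) = q * (\<Sum>l\<in>L. (norm (v l))\<^sup>2)"
    unfolding S3_def
  proof (rule sum_norm_trig_poly_square[OF q fin(3)])
    fix i j assume "i \<in> L" "j \<in> L"
    then have "i \<le> Q" "j \<le> Q" using Q by auto
    then show "\<bar>int i - int j\<bar> < int q" by (simp add: q_def)
  qed (simp add: inj_on_def)
  finally have "real q * norm (\<Sum>n\<in>I. \<Sum>m\<in>J. \<Sum>l\<in>L. if n + l = 2 * m then b n * u m * v l else 0)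
    \<le> real q * (S / 2 * ((\<Sum>m\<in>J. (norm (u m))\<^sup>2) + (\<Sum>l\<in>L. (norm (v l))\<^sup>2)))"
    by (simp add: algebra_simps)
  then show ?thesis using q by (simp only: mult_le_cancel_left_pos of_nat_0_less_iff)
qed

section \<open>Trigonometric series with bounded sum\<close>

lemma pi_less_3_2: "pi < 3.2"
  using pi_approx(2) by (rule order_le_less_trans) simp

text \<open>A geometric sum with ratio z has norm at most 2 / |1 - z|, and |1 - z| = 2 sin t with t
  = pi r / q in (0, pi/2]. There t^2 <= 1.6^2 < 3, so the cubic Taylor bound gives sin t >= t/2 >=
  r/q.\<close>

lemma norm_dirichlet_kernel_le:
  assumes "0 < r" "2 * r \<le> q"
  shows "norm (\<Sum>n\<in>{M<..M'}. cis (2 * pi * (real n * (real r / real q)))) \<le> real q / real r"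
proof (cases "M \<le> M'")
  case True
  define t where "t = pi * real r / real q"
  define z where "z = cis (2 * t)"
  have q: "real q > 0" using assms by linarith
  have t: "0 < t" "t \<le> pi / 2" using assms q by (auto simp: t_def field_simps)
  have "\<bar>sin t - t\<bar> \<le> t ^ 3 / 6"
    using Maclaurin_sin_bound[of t 3] t by (simp add: sin_coeff_def eval_nat_numeral)
  moreover have "t ^ 3 \<le> 3 * t"
  proof -
    have "t \<le> 1.6" using t pi_less_3_2 by linarith
    then have "t * t \<le> 1.6 * 1.6" using t by (intro mult_mono) auto
    then have "t * (t * t) \<le> t * 3" using t by (intro mult_left_mono) auto
    then show ?thesis by (simp add: power3_eq_cube mult_ac)
  qed
  ultimately have "sin t \<ge> t / 2" by linarith
  moreover have "t / 2 \<ge> real r / real q" 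
    using mult_right_mono[OF pi_ge_two, of "real r / real q"] q by (simp add: t_def)
  ultimately have sint: "sin t \<ge> real r / real q" by linarith
  have "norm (z - 1) = 2 * \<bar>sin t\<bar>"
    using dist_exp_i_1[of "2 * t"] by (simp add: z_def cis_conv_exp)
  then have nz: "norm (1 - z) \<ge> 2 * (real r / real q)" using sint by (simp add: norm_minus_commute)
  have "real r / real q > 0" using assms q by simp
  have "(\<Sum>n\<in>{M<..M'}. cis (2 * pi * (real n * (real r / real q)))) = (\<Sum>n\<in>{Suc M..M'}. z ^ n)"
  proof (rule sum.cong)
    fix n
    have "real n * (2 * t) = 2 * pi * (real n * (real r / real q))" by (simp add: t_def)
    then show "cis (2 * pi * (real n * (real r / real q))) = z ^ n" by (simp only: z_def Complex.DeMoivre)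
  qed auto
  moreover have "(1 - z) * (\<Sum>n\<in>{Suc M..M'}. z ^ n) = z ^ Suc M - z ^ Suc M'"
    using sum_gp_multiplied[of "Suc M" M' z] True
    by (cases "M = M'") (simp_all add: )
  ultimately have "norm (1 - z) * norm (\<Sum>n\<in>{M<..M'}. cis (2 * pi * (real n * (real r / real q)))) = norm (z ^ Suc M - z ^ Suc M')"
    by (simp only: norm_mult[symmetric])
  also have "\<dots> \<le> 2"
    by (rule order_trans[OF norm_triangle_ineq4]) (simp add: z_def norm_power norm_mult)
  finally have "norm (1 - z) * norm (\<Sum>n\<in>{M<..M'}. cis (2 * pi * (real n * (real r / real q)))) \<le> 2" .
  then have "2 * (real r / real q) * norm (\<Sum>n\<in>{M<..M'}. cis (2 * pi * (real n * (real r / real q)))) \<le> 2"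
    using mult_right_mono[OF nz norm_ge_zero] by (meson order_trans)
  then show ?thesis using assms q by (simp add: field_simps)
qed (use assms in auto)

lemma sum_inverse_le_ln:
  assumes "0 < p" "p \<le> m"
  shows "(\<Sum>r\<in>{p<..m}. 1 / real r) \<le> ln (real m / real p)"
  using assms(2)
proof (induction m rule: dec_induct)
  case (step m)
  have "1 / real (Suc m) \<le> ln (real (Suc m)) - ln (real m)"
  proof -
    have "ln (real m / real (Suc m)) \<le> real m / real (Suc m) - 1"
      using step assms by (intro ln_le_minus_one) auto
    also have "\<dots> = - 1 / real (Suc m)" by (simp add: field_simps)
    finally show ?thesis using step assms by (simp add: ln_div)
  qed
  moreover have "{p<..Suc m} = insert (Suc m) {p<..m}" using step by auto
  ultimately show ?case using step assms by (simp add: ln_div)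
qed (use assms in simp)

text \<open>Making q a multiple p X of the length puts the change from the trivial bound X to the
  bound q/r exactly at r = p: the range r <= p contributes p X = q, the rest q ln X, and the
  symmetry r -> q - r doubles both. The term r = 0 accounts for the remaining q. The result is
  independent of p, so q may be taken as large as the frequencies demand.\<close>

lemma sum_norm_dirichlet_kernel_le:
  fixes p :: nat
  assumes "M < M'" "0 < p" and X: "X = M' - M" and q: "q = p * X"
  shows "(\<Sum>r<q. norm (\<Sum>n\<in>{M<..M'}. cis (2 * pi * (real n * (real r / real q)))))
     \<le> real q * (3 + 2 * ln X)"
proof -
  define D where "D = (\<lambda>r. norm (\<Sum>n\<in>{M<..M'}. cis (2 * pi * (real n * (real r / real q)))))"
  define g where "g = (\<lambda>r::nat. min (real X) (real q / real r))"
  have X1: "X \<ge> 1" using assms by simp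
  have q0: "q > 0" using X1 assms by simp
  have g0: "g r \<ge> 0" for r by (simp add: g_def)
  have DX: "D r \<le> real X" for r
    unfolding D_def by (rule order_trans[OF norm_sum]) (use X assms in simp)
  have Dg: "D r \<le> g r" if "0 < r" "2 * r \<le> q" for r
    using DX[of r] norm_dirichlet_kernel_le[OF that] by (simp add: g_def D_def)
  have Drefl: "D r = D (q - r)" if "r < q" for r
  proof -
    have "cis (2 * pi * (real n * (real (q - r) / real q))) = cnj (cis (2 * pi * (real n * (real r / real q))))" for n
    proof -
      have "2 * pi * (real n * (real (q - r) / real q)) = 2 * pi * real n - 2 * pi * (real n * (real r / real q))"
        using that by (simp add: of_nat_diff field_simps)
      then show ?thesis by (simp add: cis_divide[symmetric] cis_cnj divide_inverse)
    qed
    then have "D (q - r) = norm (cnj (\<Sum>n\<in>{M<..M'}. cis (2 * pi * (real n * (real r / real q)))))"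
      unfolding D_def by (simp only: cnj_sum)
    then show ?thesis by (simp only: complex_mod_cnj D_def)
  qed
  have Dgg: "D r \<le> g r + g (q - r)" if "r \<in> {1..<q}" for r
  proof (cases "2 * r \<le> q")
    case True then show ?thesis using Dg[of r] that g0[of "q - r"] by auto
  next
    case False
    then have "D (q - r) \<le> g (q - r)" using that by (intro Dg) auto
    then show ?thesis using g0[of r] Drefl[of r] that by auto
  qed
  have split: "{..<q} = insert 0 {1..<q}" using q0 by auto
  have "(\<Sum>r<q. D r) = D 0 + (\<Sum>r\<in>{1..<q}. D r)" unfolding split by simp
  also have "\<dots> \<le> real X + (\<Sum>r\<in>{1..<q}. g r + g (q - r))"
    by (intro add_mono DX sum_mono Dgg)
  also have "\<dots> = real X + 2 * (\<Sum>r\<in>{1..<q}. g r)"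
  proof -
    have "(\<Sum>r\<in>{1..<q}. g (q - r)) = (\<Sum>r\<in>{1..<q}. g r)"
      by (rule sum.reindex_bij_witness[of _ "\<lambda>r. q - r" "\<lambda>r. q - r"]) auto
    then show ?thesis by (simp add: sum.distrib)
  qed
  also have "(\<Sum>r\<in>{1..<q}. g r) \<le> (\<Sum>r\<in>{0<..p} \<union> {p<..q}. g r)"
    by (intro sum_mono2) (use g0 in auto)
  also have "\<dots> = (\<Sum>r\<in>{0<..p}. g r) + (\<Sum>r\<in>{p<..q}. g r)"
    by (intro sum.union_disjoint) auto
  also have "(\<Sum>r\<in>{0<..p}. g r) \<le> (\<Sum>r\<in>{0<..p}. real X)" by (intro sum_mono) (simp add: g_def)
  also have "(\<Sum>r\<in>{p<..q}. g r) \<le> (\<Sum>r\<in>{p<..q}. real q * (1 / real r))" by (intro sum_mono) (simp add: g_def)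
  also have "\<dots> = real q * (\<Sum>r\<in>{p<..q}. 1 / real r)" by (simp add: sum_distrib_left)
  also have "\<dots> \<le> real q * ln (real q / real p)"
    using X1 assms by (intro mult_left_mono sum_inverse_le_ln) auto
  also have "real q / real p = real X" using assms by simp
  also have "(\<Sum>r\<in>{0<..p}. real X) = real q" using q by simp
  finally have "(\<Sum>r<q. D r) \<le> real X + 2 * (real q + real q * ln (real X))"
    by simp
  moreover have "real X \<le> real q" using assms by (cases p) auto
  ultimately have "(\<Sum>r<q. D r) \<le> real q + 2 * (real q + real q * ln (real X))" by linarith
  then show ?thesis by (simp add: D_def algebra_simps)
qed

text \<open>Summability at x = 0 is absolute for complex series, so the tail is small uniformly in
  x. This passes from the series to trigonometric polynomials, to which exact averaging over r/q
  applies; \<open>A0\<close> prescribes frequencies that the polynomial must retain.\<close>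

lemma norm_partial_trig_sum_le:
  fixes c :: "int \<Rightarrow> complex"
  assumes hs: "\<And>x. ((\<lambda>n. c n * cis (2 * pi * (of_int n * x))) has_sum F x) S"
    and B: "\<And>x. norm (F x) \<le> B"
    and eta: "\<eta> > 0" and A0: "finite A0" "A0 \<subseteq> S"
  shows "\<exists>A. finite A \<and> A0 \<subseteq> A \<and> A \<subseteq> S \<and>
    (\<forall>x. norm (\<Sum>n\<in>A. c n * cis (2 * pi * (of_int n * x))) \<le> B + \<eta>)"
proof -
  have "(c has_sum F 0) S" using hs[of 0] by simp
  then have "c summable_on S" by (auto simp: summable_on_def)
  then have abs: "(\<lambda>n. norm (c n)) summable_on S" by (simp add: summable_on_iff_abs_summable_on_complex)
  then obtain A1 where A1: "finite A1" "A1 \<subseteq> S"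
    "dist (\<Sum>n\<in>A1. norm (c n)) (\<Sum>\<^sub>\<infinity>n\<in>S. norm (c n)) \<le> \<eta>"
    using infsum_finite_approximation[OF abs eta] by auto
  define A where "A = A0 \<union> A1"
  have A: "finite A" "A \<subseteq> S" "A0 \<subseteq> A" "A1 \<subseteq> A" using A0 A1 by (auto simp: A_def)
  have tail: "(\<Sum>\<^sub>\<infinity>n\<in>S - A. norm (c n)) \<le> \<eta>"
  proof -
    have "(\<Sum>\<^sub>\<infinity>n\<in>S - A. norm (c n)) = (\<Sum>\<^sub>\<infinity>n\<in>S. norm (c n)) - (\<Sum>n\<in>A. norm (c n))"
      using infsum_Diff[OF abs summable_on_finite[OF A(1)] A(2)] A(1) by (simp add: infsum_finite)
    moreover have "(\<Sum>n\<in>A1. norm (c n)) \<le> (\<Sum>n\<in>A. norm (c n))"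
      using A by (intro sum_mono2) auto
    ultimately show ?thesis using A1(3) by (simp add: dist_real_def)
  qed
  have "norm (\<Sum>n\<in>A. c n * cis (2 * pi * (of_int n * x))) \<le> B + \<eta>" for x
  proof -
    let ?f = "\<lambda>n. c n * cis (2 * pi * (of_int n * x))"
    have fsum: "(?f has_sum (F x - sum ?f A)) (S - A)"
      using has_sum_Diff[OF hs has_sum_finite[OF A(1)] A(2)] .
    have "((\<lambda>n. norm (c n)) has_sum (\<Sum>\<^sub>\<infinity>n\<in>S - A. norm (c n))) (S - A)"
      using summable_on_subset_banach[OF abs, of "S - A"] by (intro has_sum_infsum) auto
    then have "((\<lambda>n. norm (?f n)) has_sum (\<Sum>\<^sub>\<infinity>n\<in>S - A. norm (c n))) (S - A)"
      by (simp add: norm_mult)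
    then have "norm (F x - sum ?f A) \<le> (\<Sum>\<^sub>\<infinity>n\<in>S - A. norm (c n))"
      using fsum by (rule norm_has_sum_bound)
    then have "norm (F x - sum ?f A) \<le> \<eta>" using tail by linarith
    moreover have "norm (sum ?f A) \<le> norm (F x) + norm (F x - sum ?f A)"
      using norm_triangle_ineq4[of "F x" "F x - sum ?f A"] by simp
    ultimately show ?thesis using B[of x] by linarith
  qed
  then show ?thesis by (intro exI[of _ A] conjI allI A)
qed

text \<open>Bessel's inequality, obtained from Parseval for the polynomials approximating the
  series, with \<eta> tending to 0.\<close>

lemma trig_series_parseval_bound:
  fixes c :: "int \<Rightarrow> complex"
  assumes hs: "\<And>x. ((\<lambda>n. c n * cis (2 * pi * (of_int n * x))) has_sum F x) S"
    and B: "\<And>x. norm (F x) \<le> B"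
    and A0: "finite A0" "A0 \<subseteq> S"
  shows "(\<Sum>n\<in>A0. (norm (c n))\<^sup>2) \<le> B\<^sup>2"
proof -
  have bound: "(\<Sum>n\<in>A0. (norm (c n))\<^sup>2) \<le> (B + \<eta>)\<^sup>2" if eta: "\<eta> > 0" for \<eta>
  proof -
    obtain A where "finite A \<and> A0 \<subseteq> A \<and> A \<subseteq> S \<and>
      (\<forall>x. norm (\<Sum>n\<in>A. c n * cis (2 * pi * (of_int n * x))) \<le> B + \<eta>)"
      using norm_partial_trig_sum_le[OF hs B eta A0] by (rule exE)
    note AA = this
    have A: "finite A" "A0 \<subseteq> A" "A \<subseteq> S"
      using AA by simp_all
    note AB = AA[THEN conjunct2, THEN conjunct2, THEN conjunct2, rule_format]
    have "bdd_above (abs ` A)" using A(1) by simp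
    then obtain Q where Q: "\<forall>n\<in>A. \<bar>n\<bar> \<le> Q" by (auto simp: bdd_above_def)
    define q where "q = nat (2 * \<bar>Q\<bar> + 1)"
    have q: "q > 0" by (simp add: q_def)
    have "real q * (\<Sum>n\<in>A. (norm (c n))\<^sup>2) = (\<Sum>r<q. (norm (\<Sum>n\<in>A. c n * cis (2 * pi * (of_int n * (real r / real q)))))\<^sup>2)"
    proof (rule sum_norm_trig_poly_square[symmetric, OF q A(1)])
      fix i j assume "i \<in> A" "j \<in> A"
      then have "\<bar>i\<bar> \<le> Q" "\<bar>j\<bar> \<le> Q" using Q by auto
      then show "\<bar>i - j\<bar> < int q" unfolding q_def by linarith
    qed simp
    also have "\<dots> \<le> (\<Sum>r<q. (B + \<eta>)\<^sup>2)"
      by (intro sum_mono power_mono AB) auto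
    finally have "real q * (\<Sum>n\<in>A. (norm (c n))\<^sup>2) \<le> real q * (B + \<eta>)\<^sup>2" by simp
    then have "(\<Sum>n\<in>A. (norm (c n))\<^sup>2) \<le> (B + \<eta>)\<^sup>2" using q by simp
    moreover have "(\<Sum>n\<in>A0. (norm (c n))\<^sup>2) \<le> (\<Sum>n\<in>A. (norm (c n))\<^sup>2)"
      using A by (intro sum_mono2) auto
    ultimately show ?thesis by linarith
  qed
  have "((\<lambda>\<eta>. (B + \<eta>)\<^sup>2) \<longlongrightarrow> (B + 0)\<^sup>2) (at_right 0)"
    by (intro tendsto_intros)
  moreover have "\<forall>\<^sub>F \<eta> in at_right 0. (\<Sum>n\<in>A0. (norm (c n))\<^sup>2) \<le> (B + \<eta>)\<^sup>2"
    using eventually_at_right_less[of 0] by eventually_elim (rule bound)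
  ultimately have "(\<Sum>n\<in>A0. (norm (c n))\<^sup>2) \<le> (B + 0)\<^sup>2"
    by (rule tendsto_lowerbound) simp
  then show ?thesis by simp
qed

text \<open>The partial sum is the average of P times the conjugate Dirichlet kernel, where P is an
  approximating polynomial shifted by x and hence bounded by B + \<eta>. The L^1 norm of the kernel
  gives a logarithm of the length only, whatever the number of frequencies in P.\<close>

lemma trig_series_partial_sum_bound:
  fixes c :: "int \<Rightarrow> complex"
  assumes hs: "\<And>x. ((\<lambda>n. c n * cis (2 * pi * (of_int n * x))) has_sum F x) S"
    and B: "\<And>x. norm (F x) \<le> B"
    and S: "int ` {M<..M'} \<subseteq> S" and MM: "M < M'"
  shows "norm (\<Sum>n\<in>{M<..M'}. c (int n) * cis (2 * pi * (real n * x))) \<le> B * (3 + 2 * ln (real (M' - M)))"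
proof -
  define X where "X = M' - M"
  define K where "K = 3 + 2 * ln (real X)"
  have X: "X \<ge> 1" using MM by (simp add: X_def)
  let ?T = "\<Sum>n\<in>{M<..M'}. c (int n) * cis (2 * pi * (real n * x))"
  have bound: "norm ?T \<le> (B + \<eta>) * K" if eta: "\<eta> > 0" for \<eta>
  proof -
    have fin: "finite (int ` {M<..M'})" by simp
    obtain A where "finite A \<and> int ` {M<..M'} \<subseteq> A \<and> A \<subseteq> S \<and>
      (\<forall>x. norm (\<Sum>n\<in>A. c n * cis (2 * pi * (of_int n * x))) \<le> B + \<eta>)"
      using norm_partial_trig_sum_le[OF hs B eta fin S] by (rule exE)
    note AA = this
    have A: "finite A" "int ` {M<..M'} \<subseteq> A" "A \<subseteq> S"
      using AA by simp_all
    note AB = AA[THEN conjunct2, THEN conjunct2, THEN conjunct2, rule_format]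
    have "bdd_above (abs ` A)" using A(1) by simp
    then obtain Q where Q: "\<forall>n\<in>A. \<bar>n\<bar> \<le> Q" by (auto simp: bdd_above_def)
    define p where "p = nat (2 * \<bar>Q\<bar> + 1)"
    have p: "p > 0" by (simp add: p_def)
    \<comment> \<open>q is a multiple of X, as the kernel bound requires, and exceeds 2 |Q|, hence
      all frequency differences.\<close>
    define q where "q = p * X"
    have q: "q > 0" "p \<le> q" using p X by (auto simp: q_def)
    define P where "P = (\<lambda>r. \<Sum>n\<in>A. (c n * cis (2 * pi * (of_int n * x))) * cis (2 * pi * (of_int n * (real r / real q))))"
    define D where "D = (\<lambda>r. \<Sum>n\<in>{M<..M'}. cis (2 * pi * (real n * (real r / real q))))"
    have P: "norm (P r) \<le> B + \<eta>" for r
    proof -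
      have "P r = (\<Sum>n\<in>A. c n * cis (2 * pi * (of_int n * (x + real r / real q))))"
        unfolding P_def by (intro sum.cong refl) (simp add: cis_mult distrib_left mult.assoc)
      then show ?thesis using AB by simp
    qed
    have "(\<Sum>r<q. P r * cnj (D r)) = of_nat q * (\<Sum>i\<in>A. \<Sum>n\<in>{M<..M'}. if i = int n then (c i * cis (2 * pi * (of_int i * x))) * cnj 1 else 0)"
    proof -
      have D1: "D r = (\<Sum>n\<in>{M<..M'}. 1 * cis (2 * pi * (of_int (int n) * (real r / real q))))" for r
        by (simp add: D_def)
      show ?thesis unfolding P_def D1
      proof (rule sum_trig_poly_mult_cnj[OF q(1), where \<phi> = "\<lambda>i. i" and \<psi> = int and b = "\<lambda>_. 1"
            and a = "\<lambda>i. c i * cis (2 * pi * (of_int i * x))"])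
        fix i n assume "i \<in> A" "n \<in> {M<..M'}"
        then have "\<bar>i\<bar> \<le> Q" "\<bar>int n\<bar> \<le> Q" using Q A(2) by blast+
        then show "\<bar>i - int n\<bar> < int q" using q(2) unfolding p_def by linarith
      qed
    qed
    also have "(\<Sum>i\<in>A. \<Sum>n\<in>{M<..M'}. if i = int n then (c i * cis (2 * pi * (of_int i * x))) * cnj 1 else 0)
       = (\<Sum>n\<in>{M<..M'}. \<Sum>i\<in>A. if i = int n then (c i * cis (2 * pi * (of_int i * x))) else 0)"
      by (subst sum.swap) (simp only: complex_cnj_one mult_1_right)
    also have "\<dots> = ?T"
    proof (rule sum.cong[OF refl])
      fix n assume "n \<in> {M<..M'}"
      then have "int n \<in> A" using A(2) by blast
      then show "(\<Sum>i\<in>A. if i = int n then c i * cis (2 * pi * (of_int i * x)) else 0) = c (int n) * cis (2 * pi * (real n * x))"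
        by (subst sum.delta[OF A(1)]) simp
    qed
    finally have eq: "(\<Sum>r<q. P r * cnj (D r)) = of_nat q * ?T" .
    have "real q * norm ?T = norm (\<Sum>r<q. P r * cnj (D r))" unfolding eq by (simp add: norm_mult)
    also have "\<dots> \<le> (\<Sum>r<q. (B + \<eta>) * norm (D r))"
      by (intro sum_norm_le) (simp add: norm_mult mult_right_mono P)
    also have "\<dots> = (B + \<eta>) * (\<Sum>r<q. norm (D r))" by (simp add: sum_distrib_left)
    also have "\<dots> \<le> (B + \<eta>) * (real q * K)"
    proof (rule mult_left_mono)
      show "(\<Sum>r<q. norm (D r)) \<le> real q * K"
        unfolding D_def K_def using sum_norm_dirichlet_kernel_le[OF MM p X_def q_def] .
      show "B + \<eta> \<ge> 0" using order_trans[OF norm_ge_zero P] .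
    qed
    finally have "real q * norm ?T \<le> real q * ((B + \<eta>) * K)" by (simp add: mult_ac)
    then show ?thesis using q by simp
  qed
  have "((\<lambda>\<eta>. (B + \<eta>) * K) \<longlongrightarrow> (B + 0) * K) (at_right 0)"
    by (intro tendsto_intros)
  moreover have "\<forall>\<^sub>F \<eta> in at_right 0. norm ?T \<le> (B + \<eta>) * K"
    using eventually_at_right_less[of 0] by eventually_elim (rule bound)
  ultimately have "norm ?T \<le> (B + 0) * K"
    by (rule tendsto_lowerbound) simp
  then show ?thesis by (simp add: K_def X_def)
qed

section \<open>Additive twists and mean squares\<close>

lemma norm_sum_mult_le_abel:
  fixes c g :: "nat \<Rightarrow> complex"
  assumes MM: "M < M'"
    and T: "\<And>j. M \<le> j \<Longrightarrow> j \<le> M' \<Longrightarrow> norm (\<Sum>n\<in>{M<..j}. c n) \<le> T"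
    and G: "norm (g M') \<le> G"
    and D: "\<And>n. M < n \<Longrightarrow> n < M' \<Longrightarrow> norm (g n - g (Suc n)) \<le> D" "D \<ge> 0"
  shows "norm (\<Sum>n\<in>{M<..M'}. g n * c n) \<le> T * (G + real (M' - M) * D)"
proof -
  have T0: "T \<ge> 0" using T[of M] MM by simp
  define C where "C = (\<lambda>j. \<Sum>n\<in>{M<..j}. c n)"
  have "(\<Sum>n\<in>{M<..k}. g n * c n) = g k * C k + (\<Sum>n\<in>{M<..<k}. (g n - g (Suc n)) * C n)" if "M \<le> k" for k
    using that
  proof (induction k rule: dec_induct)
    case base
    then show ?case by (simp add: C_def)
  next
    case (step k)
    have 1: "{M<..Suc k} = insert (Suc k) {M<..k}" using step by auto
    have 2: "(\<Sum>n\<in>{M<..<Suc k}. (g n - g (Suc n)) * C n) = (g k - g (Suc k)) * C k + (\<Sum>n\<in>{M<..<k}. (g n - g (Suc n)) * C n)"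
    proof (cases "k = M")
      case True
      then have "{M<..<Suc k} = {}" "{M<..<k} = {}" "C k = 0" by (auto simp: C_def)
      then show ?thesis by simp
    next
      case False
      then have "{M<..<Suc k} = insert k {M<..<k}" using step by auto
      then show ?thesis by simp
    qed
    have 3: "C (Suc k) = c (Suc k) + C k" using 1 by (simp add: C_def)
    show ?case unfolding 2 3 using step.IH 1 by (simp add: algebra_simps)
  qed
  from this[of M'] MM have eq: "(\<Sum>n\<in>{M<..M'}. g n * c n) = g M' * C M' + (\<Sum>n\<in>{M<..<M'}. (g n - g (Suc n)) * C n)"
    by simp
  have "norm (\<Sum>n\<in>{M<..M'}. g n * c n) \<le> norm (g M' * C M') + (\<Sum>n\<in>{M<..<M'}. D * T)"
    unfolding eq
  proof (rule order_trans[OF norm_triangle_ineq], intro add_left_mono sum_norm_le)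
    fix n assume n: "n \<in> {M<..<M'}"
    show "norm ((g n - g (Suc n)) * C n) \<le> D * T"
      unfolding norm_mult using n D T by (intro mult_mono) (auto simp: C_def)
  qed
  also have "norm (g M' * C M') \<le> G * T"
  proof -
    have "G \<ge> 0" using G norm_ge_zero order_trans by metis
    then show ?thesis unfolding norm_mult using G T[of M'] MM by (intro mult_mono) (auto simp: C_def)
  qed
  also have "(\<Sum>n\<in>{M<..<M'}. D * T) \<le> real (M' - M) * (D * T)"
    using D(2) T0 by (auto intro!: mult_right_mono)
  finally show ?thesis by (simp add: algebra_simps)
qed

text \<open>Wilton's bound, uniform in \<alpha> and over all intervals below X. The factor 1 + ln X
  keeps the right side positive at X = 1.\<close>

definition additive_twists_bounded :: "(nat \<Rightarrow> complex) \<Rightarrow> bool" where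
  "additive_twists_bounded lam \<longleftrightarrow> (\<exists>C. \<forall>X\<ge>1. \<forall>M M' \<alpha>. M' \<le> X \<longrightarrow>
     norm (\<Sum>n\<in>{M<..M'}. lam n * cis (2 * pi * (real n * \<alpha>))) \<le> C * (sqrt (real X) * (1 + ln (real X))))"

definition mean_square_bounded :: "(nat \<Rightarrow> complex) \<Rightarrow> bool" where
  "mean_square_bounded lam \<longleftrightarrow> (\<exists>R. \<forall>X. (\<Sum>n\<in>{0<..X}. (norm (lam n))\<^sup>2) \<le> R * real X)"

text \<open>Halving X shrinks sqrt X geometrically, so adding the dyadic blocks produces no second
  logarithm. The block end 2 Y + 1 accommodates odd X.\<close>

lemma additive_twists_bounded_dyadic:
  assumes block: "\<And>Y M M' \<alpha>. 1 \<le> Y \<Longrightarrow> Y \<le> M \<Longrightarrow> M \<le> M' \<Longrightarrow> M' \<le> 2 * Y + 1 \<Longrightarrow>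
     norm (\<Sum>n\<in>{M<..M'}. lam n * cis (2 * pi * (real n * \<alpha>))) \<le> C * (sqrt (real Y) * (1 + ln (real Y)))"
  shows "additive_twists_bounded lam"
proof -
  \<comment> \<open>With 4 C <= C1 the induction step needs 5/4 sqrt Y <= sqrt X, which follows from
    25/16 <= 2 and 2 Y <= X; the other entry starts the induction.\<close>
  define C1 where "C1 = max (4 * C) (norm (lam 1))"
  have C1: "C1 \<ge> 0" "4 * C \<le> C1" "norm (lam 1) \<le> C1" by (auto simp: C1_def le_max_iff_disj)
  have init: "norm (\<Sum>n\<in>{0<..X}. lam n * cis (2 * pi * (real n * \<alpha>))) \<le> C1 * (sqrt (real X) * (1 + ln (real X)))"
    if "1 \<le> X" for X \<alpha>
    using that
  proof (induction X rule: less_induct)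
    case (less X)
    show ?case
    proof (cases "X = 1")
      case True
      then have "{0<..X} = {1}" by auto
      then show ?thesis using True C1 by (simp add: norm_mult)
    next
      case False
      define Y where "Y = X div 2"
      have Y: "1 \<le> Y" "Y < X" "2 * Y \<le> X" "X \<le> 2 * Y + 1" using less.prems False by (auto simp: Y_def)
      have "{0<..X} = {0<..Y} \<union> {Y<..X}" using Y by auto
      then have "(\<Sum>n\<in>{0<..X}. lam n * cis (2 * pi * (real n * \<alpha>))) =
          (\<Sum>n\<in>{0<..Y}. lam n * cis (2 * pi * (real n * \<alpha>))) + (\<Sum>n\<in>{Y<..X}. lam n * cis (2 * pi * (real n * \<alpha>)))"
        by (simp add: sum.union_disjoint)
      then have "norm (\<Sum>n\<in>{0<..X}. lam n * cis (2 * pi * (real n * \<alpha>))) \<le>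
          C1 * (sqrt (real Y) * (1 + ln (real Y))) + C * (sqrt (real Y) * (1 + ln (real Y)))"
        using norm_triangle_mono[OF less.IH[OF Y(2,1)] block[OF Y(1), of Y X]] Y by simp
      also have "\<dots> = (C1 + C) * (sqrt (real Y) * (1 + ln (real Y)))" by (simp add: algebra_simps)
      also have "\<dots> \<le> (5 / 4 * C1) * (sqrt (real Y) * (1 + ln (real Y)))"
        using C1 Y by (intro mult_right_mono mult_nonneg_nonneg) auto
      also have "\<dots> = C1 * ((5 / 4 * sqrt (real Y)) * (1 + ln (real Y)))" by simp
      also have "\<dots> \<le> C1 * (sqrt (real X) * (1 + ln (real X)))"
      proof (intro mult_left_mono mult_mono C1)
        have "5 / 4 * sqrt (real Y) = sqrt (25 / 16 * real Y)"
          by (simp add: real_sqrt_mult real_sqrt_divide)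
        also have "\<dots> \<le> sqrt (real X)"
        proof (rule real_sqrt_le_mono)
          have "2 * real Y \<le> real X" using Y by linarith
          then show "25 / 16 * real Y \<le> real X" by linarith
        qed
        finally show "5 / 4 * sqrt (real Y) \<le> sqrt (real X)" .
      qed (use Y in auto)
      finally show ?thesis .
    qed
  qed
  have "norm (\<Sum>n\<in>{M<..M'}. lam n * cis (2 * pi * (real n * \<alpha>))) \<le> (2 * C1) * (sqrt (real X) * (1 + ln (real X)))"
    if X: "1 \<le> X" "M' \<le> X" for X M M' \<alpha>
  proof (cases "M < M'")
    case True
    have init': "norm (\<Sum>n\<in>{0<..k}. lam n * cis (2 * pi * (real n * \<alpha>))) \<le> C1 * (sqrt (real X) * (1 + ln (real X)))"
      if "k \<le> X" for k
    proof (cases "k = 0")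
      case True
      then show ?thesis using C1 X by simp
    next
      case False
      have "C1 * (sqrt (real k) * (1 + ln (real k))) \<le> C1 * (sqrt (real X) * (1 + ln (real X)))"
        using C1 X that False by (intro mult_left_mono mult_mono) auto
      then show ?thesis using init[of k \<alpha>] False by linarith
    qed
    have "{0<..M'} = {0<..M} \<union> {M<..M'}" using True by auto
    then have "(\<Sum>n\<in>{M<..M'}. lam n * cis (2 * pi * (real n * \<alpha>))) =
        (\<Sum>n\<in>{0<..M'}. lam n * cis (2 * pi * (real n * \<alpha>))) - (\<Sum>n\<in>{0<..M}. lam n * cis (2 * pi * (real n * \<alpha>)))"
      by (simp add: sum.union_disjoint)
    then have "norm (\<Sum>n\<in>{M<..M'}. lam n * cis (2 * pi * (real n * \<alpha>))) \<le>
        C1 * (sqrt (real X) * (1 + ln (real X))) + C1 * (sqrt (real X) * (1 + ln (real X)))"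
      using order_trans[OF norm_triangle_ineq4 add_mono[OF init'[of M'] init'[of M]]] True X by simp
    then show ?thesis by (simp only: mult_2 distrib_right)
  next
    case False
    then show ?thesis using C1 X by simp
  qed
  then show ?thesis unfolding additive_twists_bounded_def by blast
qed

lemma mean_square_bounded_dyadic:
  assumes block: "\<And>Y. 1 \<le> Y \<Longrightarrow> (\<Sum>n\<in>{Y<..2 * Y + 1}. (norm (lam n))\<^sup>2) \<le> R * real Y"
  shows "mean_square_bounded lam"
proof -
  define R1 where "R1 = max R ((norm (lam 1))\<^sup>2)"
  have R1: "R \<le> R1" "(norm (lam 1))\<^sup>2 \<le> R1" by (auto simp: R1_def)
  have R10: "R1 \<ge> 0" using R1(2) zero_le_power2 order_trans by metis
  have "(\<Sum>n\<in>{0<..X}. (norm (lam n))\<^sup>2) \<le> R1 * real X" for X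
  proof (induction X rule: less_induct)
    case (less X)
    consider "X = 0" | "X = 1" | "X \<ge> 2" by linarith
    then show ?case
    proof cases
      case 2
      then have "{0<..X} = {1}" by auto
      then show ?thesis using 2 R1 by simp
    next
      case 3
      define Y where "Y = X div 2"
      have Y: "1 \<le> Y" "Y < X" "2 * Y \<le> X" "X \<le> 2 * Y + 1" using 3 by (auto simp: Y_def)
      have "(\<Sum>n\<in>{0<..X}. (norm (lam n))\<^sup>2) \<le> (\<Sum>n\<in>{0<..Y} \<union> {Y<..2 * Y + 1}. (norm (lam n))\<^sup>2)"
        using Y by (intro sum_mono2) auto
      also have "\<dots> = (\<Sum>n\<in>{0<..Y}. (norm (lam n))\<^sup>2) + (\<Sum>n\<in>{Y<..2 * Y + 1}. (norm (lam n))\<^sup>2)"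
        by (rule sum.union_disjoint) auto
      also have "\<dots> \<le> R1 * real Y + R * real Y"
        by (intro add_mono less.IH block Y)
      also have "\<dots> \<le> R1 * (2 * real Y)" using R1(1) by (simp add: mult_right_mono)
      also have "\<dots> \<le> R1 * real X" using Y R10 by (intro mult_left_mono) linarith+
      finally show ?thesis .
    qed simp
  qed
  then show ?thesis unfolding mean_square_bounded_def by blast
qed

context
  fixes \<kappa> :: "real \<Rightarrow> complex" and \<rho> :: "int \<Rightarrow> complex" and F :: "real \<Rightarrow> real \<Rightarrow> complex"
    and S :: "int set" and B a c \<Lambda> :: real
  assumes expansion: "\<And>x y. y > 0 \<Longrightarrow>
      ((\<lambda>n. of_real (sqrt y) * \<rho> n * \<kappa> (\<bar>of_int n\<bar> * y) * cis (2 * pi * (of_int n * x))) has_sum F x y) S"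
    and bounded: "\<And>x y. y > 0 \<Longrightarrow> norm (F x y) \<le> B"
    and S: "{1..} \<subseteq> S"
    and kernel: "a > 0" "c > 0" "\<Lambda> \<ge> 0"
      "\<And>u. u \<in> {a..3 * a} \<Longrightarrow> c \<le> norm (\<kappa> u)"
      "\<And>u v. u \<in> {a..3 * a} \<Longrightarrow> v \<in> {a..3 * a} \<Longrightarrow> norm (\<kappa> u - \<kappa> v) \<le> \<Lambda> * \<bar>u - v\<bar>"
begin

text \<open>At height y = a/Y every n in (Y, 2 Y + 1] has n y in [a, 3 a]. There the Fourier
  coefficients of F have norm at least sqrt y * c * |\<rho>(n)|, and Bessel's inequality bounds the
  sum of |\<rho>(n)|^2 by B^2 / (y c^2).\<close>

lemma expansion_imp_mean_square_bounded: "mean_square_bounded (\<lambda>n. \<rho> (int n))"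
proof (rule mean_square_bounded_dyadic[of _ "B\<^sup>2 / (a * c\<^sup>2)"])
  fix Y :: nat assume Y: "1 \<le> Y"
  define y where "y = a / real Y"
  have y: "y > 0" using Y kernel(1) by (simp add: y_def)
  have "(\<Sum>n\<in>{Y<..2 * Y + 1}. (norm (\<rho> (int n)))\<^sup>2) * (y * c\<^sup>2)
     \<le> (\<Sum>n\<in>{Y<..2 * Y + 1}. (norm (of_real (sqrt y) * \<rho> (int n) * \<kappa> (\<bar>of_int (int n)\<bar> * y)))\<^sup>2)"
    unfolding sum_distrib_right
  proof (rule sum_mono)
    fix n assume n: "n \<in> {Y<..2 * Y + 1}"
    have "real Y * a \<le> real n * a" "real n * a \<le> (3 * real Y) * a"
      using n kernel(1) Y by (intro mult_right_mono; simp)+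
    then have "real n * y \<in> {a..3 * a}" using Y by (simp add: y_def field_simps)
    then have "c \<le> norm (\<kappa> (real n * y))" by (rule kernel(4))
    then have "c\<^sup>2 \<le> (norm (\<kappa> (real n * y)))\<^sup>2" using kernel(2) by (intro power_mono) auto
    then have "(norm (\<rho> (int n)))\<^sup>2 * (y * c\<^sup>2) \<le> (norm (\<rho> (int n)))\<^sup>2 * (y * (norm (\<kappa> (real n * y)))\<^sup>2)"
      using y by (intro mult_left_mono) auto
    then show "(norm (\<rho> (int n)))\<^sup>2 * (y * c\<^sup>2) \<le> (norm (of_real (sqrt y) * \<rho> (int n) * \<kappa> (\<bar>of_int (int n)\<bar> * y)))\<^sup>2"
      using y by (simp add: norm_mult power_mult_distrib mult_ac)
  qed
  also have "\<dots> = (\<Sum>n\<in>int ` {Y<..2 * Y + 1}. (norm (of_real (sqrt y) * \<rho> n * \<kappa> (\<bar>of_int n\<bar> * y)))\<^sup>2)"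
    by (subst sum.reindex) auto
  also have "\<dots> \<le> B\<^sup>2"
    by (rule trig_series_parseval_bound[OF expansion[OF y] bounded[OF y]]) (use S in auto)
  finally show "(\<Sum>n\<in>{Y<..2 * Y + 1}. (norm (\<rho> (int n)))\<^sup>2) \<le> B\<^sup>2 / (a * c\<^sup>2) * real Y"
    using kernel Y by (simp add: y_def field_simps)
qed

text \<open>The weighted partial sums at height y = a/Y are bounded by B times a logarithm; Abel
  summation against g(n) = 1 / (sqrt y \<kappa>(n y)) removes the weight. Since y is of size 1/Y, g
  has size and total variation of order sqrt Y on the block.\<close>

lemma expansion_imp_additive_twists_bounded: "additive_twists_bounded (\<lambda>n. \<rho> (int n))"
proof -
  \<comment> \<open>The size 1 / (sqrt y c) plus 2 Y increments \<Lambda> y / (sqrt y c^2),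
    evaluated at y = a/Y.\<close>
  define K where "K = (1 / c + 2 * a * \<Lambda> / c\<^sup>2) / sqrt a"
  have K0: "K \<ge> 0" using kernel by (simp add: K_def)
  have B0: "B \<ge> 0" using order_trans[OF norm_ge_zero bounded[of 1 0]] by simp
  show ?thesis
  proof (rule additive_twists_bounded_dyadic[of _ "5 * B * K"])
    fix Y M M' :: nat and \<alpha> :: real
    assume Y: "1 \<le> Y" "Y \<le> M" "M \<le> M'" "M' \<le> 2 * Y + 1"
    show "norm (\<Sum>n\<in>{M<..M'}. \<rho> (int n) * cis (2 * pi * (real n * \<alpha>)))
      \<le> 5 * B * K * (sqrt (real Y) * (1 + ln (real Y)))"
    proof (cases "M = M'")
      case True
      then show ?thesis using B0 K0 Y by simp
    next
      case False
      then have lt: "M < M'" using Y by simp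
      define y where "y = a / real Y"
      have y: "y > 0" using Y kernel(1) by (simp add: y_def)
      \<comment> \<open>The length j - M is at most Y + 1 <= 2 Y, and 3 + 2 ln (2 Y) <= 5 + 2 ln
        Y.\<close>
      define T where "T = B * (5 + 2 * ln (real Y))"
      define g where "g = (\<lambda>n. 1 / (of_real (sqrt y) * \<kappa> (real n * y)))"
      define d where "d = (\<lambda>n. of_real (sqrt y) * \<rho> (int n) * \<kappa> (\<bar>of_int (int n)\<bar> * y) * cis (2 * pi * (real n * \<alpha>)))"
      have range: "real n * y \<in> {a..3 * a}" if "n \<in> {M<..M'}" for n
      proof -
        have "real Y * a \<le> real n * a" "real n * a \<le> (3 * real Y) * a"
          using that kernel(1) Y by (intro mult_right_mono; simp)+
        then show ?thesis using Y by (simp add: y_def field_simps)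
      qed
      have nz: "c \<le> norm (\<kappa> (real n * y))" if "n \<in> {M<..M'}" for n
        by (rule kernel(4)[OF range[OF that]])
      have "(\<Sum>n\<in>{M<..M'}. \<rho> (int n) * cis (2 * pi * (real n * \<alpha>))) = (\<Sum>n\<in>{M<..M'}. g n * d n)"
      proof (rule sum.cong[OF refl])
        fix n assume "n \<in> {M<..M'}"
        then have "\<kappa> (real n * y) \<noteq> 0" using nz[of n] kernel(2) by auto
        then show "\<rho> (int n) * cis (2 * pi * (real n * \<alpha>)) = g n * d n" using y by (simp add: g_def d_def)
      qed
      also have "norm \<dots> \<le> T * (1 / (sqrt y * c) + real (M' - M) * (\<Lambda> * y / (sqrt y * c\<^sup>2)))"
      proof (rule norm_sum_mult_le_abel[OF lt])
        fix j assume j: "M \<le> j" "j \<le> M'"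
        show "norm (\<Sum>n\<in>{M<..j}. d n) \<le> T"
        proof (cases "j = M")
          case True
          then show ?thesis using B0 Y by (simp add: T_def)
        next
          case False
          have "norm (\<Sum>n\<in>{M<..j}. d n) \<le> B * (3 + 2 * ln (real (j - M)))"
            unfolding d_def
            by (rule trig_series_partial_sum_bound[OF expansion[OF y] bounded[OF y]])
              (use S False j in auto)
          also have "ln (real (j - M)) \<le> ln (2 * real Y)"
            using False j Y by (intro ln_mono) (auto simp: of_nat_diff)
          also have "ln (2 * real Y) \<le> 1 + ln (real Y)"
            using Y ln_2_less_1 by (simp add: ln_mult)
          finally show ?thesis using B0 by (simp add: T_def mult_left_mono)
        qed
      next
        show "norm (g M') \<le> 1 / (sqrt y * c)"
          unfolding g_def norm_divide norm_mult
          using nz[of M'] lt y kernel(2) by (intro divide_mono mult_mono) auto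
      next
        fix n assume n: "M < n" "n < M'"
        then have n': "n \<in> {M<..M'}" "Suc n \<in> {M<..M'}" by auto
        have k0: "\<kappa> (real n * y) \<noteq> 0" "\<kappa> (real (Suc n) * y) \<noteq> 0"
          using nz[OF n'(1)] nz[OF n'(2)] kernel(2) by auto
        have "g n - g (Suc n) = (\<kappa> (real (Suc n) * y) - \<kappa> (real n * y)) /
            (of_real (sqrt y) * (\<kappa> (real n * y) * \<kappa> (real (Suc n) * y)))"
          using k0 y by (simp add: g_def divide_simps) 
        then have "norm (g n - g (Suc n)) = norm (\<kappa> (real (Suc n) * y) - \<kappa> (real n * y)) /
            (sqrt y * (norm (\<kappa> (real n * y)) * norm (\<kappa> (real (Suc n) * y))))"
          using y by (simp add: norm_divide norm_mult)
        also have "\<dots> \<le> (\<Lambda> * y) / (sqrt y * (c * c))"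
        proof (intro divide_mono mult_mono)
          show "norm (\<kappa> (real (Suc n) * y) - \<kappa> (real n * y)) \<le> \<Lambda> * y"
            using kernel(5)[OF range[OF n'(2)] range[OF n'(1)]] y by (simp add: algebra_simps)
        qed (use nz[OF n'(1)] nz[OF n'(2)] y kernel in auto)
        finally show "norm (g n - g (Suc n)) \<le> \<Lambda> * y / (sqrt y * c\<^sup>2)" by (simp add: power2_eq_square)
      qed (use y kernel in auto)
      also have "\<dots> \<le> T * (1 / (sqrt y * c) + (2 * real Y) * (\<Lambda> * y / (sqrt y * c\<^sup>2)))"
        using Y B0 y kernel by (intro mult_left_mono add_left_mono mult_right_mono) (auto simp: T_def)
      also have "1 / (sqrt y * c) + (2 * real Y) * (\<Lambda> * y / (sqrt y * c\<^sup>2)) = K * sqrt (real Y)"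
        using Y kernel by (simp add: K_def y_def real_sqrt_divide field_simps power2_eq_square)
      also have "T * (K * sqrt (real Y)) \<le> (5 * B * (1 + ln (real Y))) * (K * sqrt (real Y))"
      proof (rule mult_right_mono)
        have "B * (5 + 2 * ln (real Y)) \<le> B * (5 + 5 * ln (real Y))"
          using Y B0 by (intro mult_left_mono) auto
        then show "T \<le> 5 * B * (1 + ln (real Y))" by (simp add: T_def algebra_simps)
      qed (use K0 in auto)
      finally show ?thesis by (simp add: mult_ac)
    qed
  qed
qed

end

section \<open>Boundedness of automorphic expansions\<close>

lemma additive_twists_bounded_cong:
  assumes "\<And>n. n \<ge> 1 \<Longrightarrow> lam n = lam' n" and b: "additive_twists_bounded lam'"
  shows "additive_twists_bounded lam"
proof -
  have "(\<Sum>n\<in>{M<..M'}. lam n * cis (2 * pi * (real n * \<alpha>))) = (\<Sum>n\<in>{M<..M'}. lam' n * cis (2 * pi * (real n * \<alpha>)))" for M M' \<alpha>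
    by (intro sum.cong refl) (simp add: assms(1))
  then show ?thesis using b unfolding additive_twists_bounded_def by (simp only:)
qed

lemma mean_square_bounded_cong:
  assumes "\<And>n. n \<ge> 1 \<Longrightarrow> lam n = lam' n" and b: "mean_square_bounded lam'"
  shows "mean_square_bounded lam"
proof -
  have "(\<Sum>n\<in>{0<..X}. (norm (lam n))\<^sup>2) = (\<Sum>n\<in>{0<..X}. (norm (lam' n))\<^sup>2)" for X
    by (intro sum.cong refl) (simp add: assms(1))
  then show ?thesis using b unfolding mean_square_bounded_def by (simp only:)
qed

section \<open>Translates away from the real axis and the invariant y^(k/2) |f|\<close>

lemma Im_moebius:
  fixes a b c d :: int
  assumes det: "a * d - b * c = 1"
  shows "Im ((of_int a * z + of_int b) / (of_int c * z + of_int d)) = Im z / (norm (of_int c * z + of_int d))\<^sup>2"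
proof -
  have "real_of_int a * real_of_int d - real_of_int b * real_of_int c = 1"
    using arg_cong[OF det, of real_of_int] by simp
  then have "(real_of_int a * Im z) * (real_of_int c * Re z + real_of_int d) - (real_of_int a * Re z + real_of_int b) * (real_of_int c * Im z) = Im z"
    by algebra
  then show ?thesis by (simp add: Im_divide cmod_power2)
qed

text \<open>A substitute for reduction theory: Dirichlet approximation to \<open>Re z\<close> already yields a
  translate of \<open>z\<close> that stays away from the real axis.\<close>
lemma exists_moebius_Im_ge:
  assumes "Im z > 0"
  shows "\<exists>a b c d :: int. a * d - b * c = 1 \<and> of_int c * z + of_int d \<noteq> 0 \<and>
     Im ((of_int a * z + of_int b) / (of_int c * z + of_int d)) \<ge> 1 / 5"
proof (cases "Im z \<ge> 1")
  case True
  then show ?thesis by (intro exI[of _ 1] exI[of _ 0]) simp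
next
  case False
  define y where "y = Im z"
  have y: "0 < y" "y < 1" using assms False by (auto simp: y_def)
  \<comment> \<open>This size balances the two parts of |k z - h|^2: the real part is below 1/Q <= 2
    sqrt y, the imaginary part k y is at most Q y <= sqrt y. The sum 4 y + y = 5 y is the origin of
    the height 1/5.\<close>
  define Q where "Q = nat \<lfloor>1 / sqrt y\<rfloor>"
  have sy: "0 < sqrt y" "sqrt y < 1" using y by auto
  have Q1: "1 \<le> Q" using sy by (simp add: Q_def le_nat_iff le_floor_iff)
  have Qle: "real Q \<le> 1 / sqrt y" using sy by (simp add: Q_def)
  have "1 / sqrt y < real Q + 1" using sy by (simp add: Q_def)
  then have "1 / sqrt y \<le> 2 * real Q" using Q1 by linarith
  then have Qge: "1 / real Q \<le> 2 * sqrt y" using Q1 sy by (simp add: field_simps)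
  obtain h k where hk: "coprime h k" "0 < k" "k \<le> int Q" "\<bar>of_int k * Re z - of_int h\<bar> < 1 / real Q"
    using Dirichlet_approx_coprime[of Q "Re z"] Q1 by auto
  obtain u v where uv: "u * h + v * k = 1" using bezout_int[of h k] hk(1) by auto
  \<comment> \<open>The Bezout coefficients complete the bottom row (k, -h) to determinant u h + v k
    = 1.\<close>
  define a b c d where "a = - u" and "b = - v" and "c = k" and "d = - h"
  have det: "a * d - b * c = 1" using uv by (simp add: a_def b_def c_def d_def)
  have "(norm (of_int c * z + of_int d))\<^sup>2 = (of_int k * Re z - of_int h)\<^sup>2 + (of_int k * y)\<^sup>2"
    by (simp add: cmod_power2 c_def d_def y_def)
  also have "(of_int k * Re z - of_int h)\<^sup>2 \<le> (2 * sqrt y)\<^sup>2"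
    using hk(4) Qge y by (intro power2_le_iff_abs_le[THEN iffD2]) auto
  also have "(2 * sqrt y)\<^sup>2 = 4 * y" using y by (simp add: power_mult_distrib)
  also have "(of_int k * y)\<^sup>2 \<le> (1 / sqrt y * y)\<^sup>2"
  proof (intro power_mono mult_right_mono)
    have "real_of_int k \<le> real Q" using hk(3) by linarith
    then show "real_of_int k \<le> 1 / sqrt y" using Qle by linarith
  qed (use y hk in auto)
  also have "(1 / sqrt y * y)\<^sup>2 = y" using y by (simp add: power_mult_distrib power_divide power2_eq_square)
  finally have n5: "(norm (of_int c * z + of_int d))\<^sup>2 \<le> 5 * y" by simp
  have nz: "of_int c * z + of_int d \<noteq> 0"
  proof
    assume "of_int c * z + of_int d = 0"
    then have "Im (of_int c * z + of_int d) = 0" by simp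
    then show False using hk(2) assms by (simp add: c_def)
  qed
  then have "0 < (norm (of_int c * z + of_int d))\<^sup>2" by simp
  then have "1 / 5 \<le> y / (norm (of_int c * z + of_int d))\<^sup>2" using n5 by (simp add: field_simps)
  then show ?thesis using det nz Im_moebius[OF det, of z] unfolding y_def by metis
qed

text \<open>With r = |c z + d|, a group element divides Im z by r^2 and multiplies |f| by r^k, so
  Im^(k/2) |f| is invariant and its supremum is already seen above height 1/5.\<close>

lemma modular_bounded_on_upper_half_plane:
  assumes mod: "modular_of_weight k f"
    and B: "\<And>z. Im z \<ge> 1 / 5 \<Longrightarrow> Im z powr (real_of_int k / 2) * norm (f z) \<le> B"
    and z: "Im z > 0"
  shows "Im z powr (real_of_int k / 2) * norm (f z) \<le> B"
proof -
  obtain a b c d :: int where g: "a * d - b * c = 1" "of_int c * z + of_int d \<noteq> 0"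
     "Im ((of_int a * z + of_int b) / (of_int c * z + of_int d)) \<ge> 1 / 5"
    using exists_moebius_Im_ge[OF z] by blast
  define w where "w = (of_int a * z + of_int b) / (of_int c * z + of_int d)"
  define r where "r = norm (of_int c * z + of_int d)"
  have r: "r > 0" using g(2) by (simp add: r_def)
  have fw: "f w = (of_int c * z + of_int d) powi k * f z"
    using mod g(1) z unfolding modular_of_weight_def w_def upper_half_plane_def by blast
  have "norm (f w) = r powi k * norm (f z)"
    unfolding fw by (simp add: norm_mult norm_power_int r_def)
  also have "r powi k = r powr real_of_int k" using r by (simp add: powr_real_of_int')
  finally have nf: "norm (f w) = r powr real_of_int k * norm (f z)" .
  have "Im w = Im z / r\<^sup>2" unfolding w_def r_def by (rule Im_moebius[OF g(1)])
  then have "Im w powr (real_of_int k / 2) = Im z powr (real_of_int k / 2) / (r\<^sup>2) powr (real_of_int k / 2)"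
    using z r by (simp add: powr_divide)
  also have "(r\<^sup>2) powr (real_of_int k / 2) = r powr real_of_int k"
    using r by (simp add: powr_powr powr_numeral[symmetric] del: powr_numeral)
  finally have "Im w powr (real_of_int k / 2) * norm (f w) = Im z powr (real_of_int k / 2) * norm (f z)"
    using nf r by simp
  then show ?thesis using B[of w] g(3) by (simp add: w_def)
qed

text \<open>What the two kernels have in common. Decay is asked from 1/5 on because |n| y >= 1/5 for
  n \<noteq> 0 and y >= 1/5. The lower bound is asked only far out, as K_{i \<nu>} may vanish at
  small arguments, and its rate 20 leaves room above the rate 4 pi obtained for the Bessel
  kernel.\<close>

definition exponential_kernel :: "(real \<Rightarrow> complex) \<Rightarrow> bool" where
  "exponential_kernel \<kappa> \<longleftrightarrow>
     (\<exists>C. \<forall>u\<ge>1 / 5. norm (\<kappa> u) \<le> C * exp (- u)) \<and>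
     (\<exists>a>0. \<exists>c>0. \<forall>u\<ge>a. c * exp (- (20 * u)) \<le> norm (\<kappa> u)) \<and>
     (\<forall>a>0. \<exists>\<Lambda>\<ge>0. \<forall>u\<in>{a..3 * a}. \<forall>v\<in>{a..3 * a}. norm (\<kappa> u - \<kappa> v) \<le> \<Lambda> * \<bar>u - v\<bar>)"

lemma sqrt_le_exp_half: "sqrt v \<le> exp (v / 2)" for v :: real
proof -
  have "v \<le> exp v" using exp_ge_add_one_self[of v] by linarith
  then have "sqrt v \<le> sqrt (exp v)" by (rule real_sqrt_le_mono)
  also have "sqrt (exp v) = exp (v / 2)"
    by (rule real_sqrt_unique) (simp_all add: power2_eq_square exp_add[symmetric])
  finally show ?thesis .
qed

text \<open>Convergence at the single height \<open>1 / 400\<close> controls the size of the coefficients, and the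
  decay of the kernel then bounds the series above height \<open>1 / 5\<close>.\<close>
lemma expansion_bounded_near_cusp:
  fixes \<kappa> :: "real \<Rightarrow> complex" and \<rho> :: "int \<Rightarrow> complex"
  assumes expansion: "\<And>x y. y > 0 \<Longrightarrow>
      ((\<lambda>n. of_real (sqrt y) * \<rho> n * \<kappa> (\<bar>of_int n\<bar> * y) * cis (2 * pi * (of_int n * x))) has_sum F x y) S"
    and S: "0 \<notin> S" and kernel: "exponential_kernel \<kappa>"
  shows "\<exists>B. \<forall>x y. y \<ge> 1 / 5 \<longrightarrow> norm (F x y) \<le> B"
proof -
  obtain C where C: "\<forall>u\<ge>1 / 5. norm (\<kappa> u) \<le> C * exp (- u)" using kernel by (auto simp: exponential_kernel_def)
  obtain a c where ac: "a > 0" "c > 0" "\<forall>u\<ge>a. c * exp (- (20 * u)) \<le> norm (\<kappa> u)"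
    using kernel unfolding exponential_kernel_def by blast
  have C0: "C \<ge> 0" using order_trans[OF norm_ge_zero C[rule_format, of 1]] by (simp add: zero_le_mult_iff)
  \<comment> \<open>From height 1/400 to a height y >= 1/5 the kernel argument grows from u to some
    v >= 80 u. Half of the decay exp(-v) absorbs sqrt y; the other half, exp(-v/2) <= exp(-40 u),
    stays below the lower bound of rate 20 at u.\<close>
  define y0 :: real where "y0 = 1 / 400"
  define g where "g = (\<lambda>n. C / (c * sqrt y0) * norm (of_real (sqrt y0) * \<rho> n * \<kappa> (\<bar>of_int n\<bar> * y0)))"
  \<comment> \<open>\<open>g\<close> dominates the terms with u >= a by comparison with the series
    at height y0. \<open>h\<close> takes care of the finitely many n with |n| y0 < a, where no lower
    bound for the kernel is available.\<close>
  define h where "h = (\<lambda>n. if \<bar>real_of_int n\<bar> < 400 * a then C * norm (\<rho> n) else 0)"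
  have "(\<lambda>n. of_real (sqrt y0) * \<rho> n * \<kappa> (\<bar>of_int n\<bar> * y0)) summable_on S"
    using expansion[of y0 0] by (auto simp: summable_on_def y0_def)
  then have g: "g summable_on S"
    unfolding g_def summable_on_iff_abs_summable_on_complex by (rule summable_on_cmult_right)
  have "finite {n. \<bar>real_of_int n\<bar> < 400 * a}"
  proof (rule finite_subset)
    show "{n. \<bar>real_of_int n\<bar> < 400 * a} \<subseteq> {- \<lceil>400 * a\<rceil>..\<lceil>400 * a\<rceil>}"
    proof
      fix n :: int assume "n \<in> {n. \<bar>real_of_int n\<bar> < 400 * a}"
      then have "\<bar>real_of_int n\<bar> \<le> real_of_int \<lceil>400 * a\<rceil>" using le_of_int_ceiling[of "400 * a"] by (simp only: mem_Collect_eq)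
      then have "\<bar>n\<bar> \<le> \<lceil>400 * a\<rceil>" by linarith
      then show "n \<in> {- \<lceil>400 * a\<rceil>..\<lceil>400 * a\<rceil>}" by auto
    qed
  qed simp
  then have "h summable_on (S \<inter> {n. \<bar>real_of_int n\<bar> < 400 * a})" by (intro summable_on_finite) auto
  moreover have "h summable_on (S \<inter> {n. \<bar>real_of_int n\<bar> < 400 * a}) \<longleftrightarrow> h summable_on S"
    by (rule summable_on_cong_neutral) (auto simp: h_def)
  ultimately have "h summable_on S" by simp
  with g have gh: "(\<lambda>n. g n + h n) summable_on S" by (rule summable_on_add)
  have g0: "0 \<le> g n" for n using C0 ac by (simp add: g_def y0_def)
  have h0: "0 \<le> h n" for n using C0 by (simp add: h_def)
  have summand: "norm (of_real (sqrt y) * \<rho> n * \<kappa> (\<bar>of_int n\<bar> * y) * cis (2 * pi * (of_int n * x))) \<le> g n + h n"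
    if n: "n \<in> S" and y: "y \<ge> 1 / 5" for n x y
  proof -
    define u where "u = \<bar>real_of_int n\<bar> * y0"
    define v where "v = \<bar>real_of_int n\<bar> * y"
    have n1: "\<bar>real_of_int n\<bar> \<ge> 1" using n S by (cases "n = 0") auto
    then have yv: "y \<le> v" using y mult_right_mono[OF n1, of y] by (simp add: v_def)
    have "\<bar>real_of_int n\<bar> * (80 * y0) \<le> v" unfolding v_def using y by (intro mult_left_mono) (auto simp: y0_def)
    then have uv: "80 * u \<le> v" by (simp add: u_def)
    have "sqrt y * norm (\<kappa> v) \<le> exp (v / 2) * (C * exp (- v))"
    proof (rule mult_mono)
      show "sqrt y \<le> exp (v / 2)" using real_sqrt_le_mono[OF yv] sqrt_le_exp_half[of v] by linarith
      show "norm (\<kappa> v) \<le> C * exp (- v)" using C y yv by simp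
    qed simp_all
    also have "\<dots> = C * exp (- (v / 2))" by (simp add: exp_add[symmetric] mult_ac exp_minus)
      (simp add: exp_minus[symmetric] exp_add[symmetric])
    finally have kv: "sqrt y * norm (\<kappa> v) \<le> C * exp (- (v / 2))" .
    have norm_eq: "norm (of_real (sqrt y) * \<rho> n * \<kappa> (\<bar>of_int n\<bar> * y) * cis (2 * pi * (of_int n * x)))
       = (sqrt y * norm (\<kappa> v)) * norm (\<rho> n)" using y by (simp add: norm_mult v_def)
    show ?thesis
    proof (cases "u \<ge> a")
      case True
      have "exp (- (v / 2)) \<le> exp (- (20 * u))" using uv True ac by simp
      also have "\<dots> \<le> norm (\<kappa> u) / c" using ac True by (simp add: field_simps)
      finally have "C * exp (- (v / 2)) \<le> C * (norm (\<kappa> u) / c)" using C0 by (rule mult_left_mono)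
      then have "sqrt y * norm (\<kappa> v) \<le> C * (norm (\<kappa> u) / c)" using kv by linarith
      then have "(sqrt y * norm (\<kappa> v)) * norm (\<rho> n) \<le> (C * (norm (\<kappa> u) / c)) * norm (\<rho> n)"
        by (rule mult_right_mono) simp
      also have "\<dots> = g n" by (simp add: g_def norm_mult u_def y0_def field_simps)
      finally show ?thesis using norm_eq h0[of n] by linarith
    next
      case False
      then have "\<bar>real_of_int n\<bar> < 400 * a" by (simp add: u_def y0_def)
      then have h: "h n = C * norm (\<rho> n)" by (simp add: h_def)
      have "exp (- (v / 2)) \<le> 1" using yv y by simp
      then have "C * exp (- (v / 2)) \<le> C * 1" using C0 by (rule mult_left_mono)
      then have "(sqrt y * norm (\<kappa> v)) * norm (\<rho> n) \<le> C * norm (\<rho> n)"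
        using kv by (intro mult_right_mono) auto
      then show ?thesis using norm_eq h g0[of n] by linarith
    qed
  qed
  have "norm (F x y) \<le> (\<Sum>\<^sub>\<infinity>n\<in>S. g n + h n)" if y: "y \<ge> 1 / 5" for x y
  proof -
    let ?f = "\<lambda>n. of_real (sqrt y) * \<rho> n * \<kappa> (\<bar>of_int n\<bar> * y) * cis (2 * pi * (of_int n * x))"
    have "(sum ?f \<longlongrightarrow> F x y) (finite_subsets_at_top S)"
      using expansion[of y x] y unfolding has_sum_def by simp
    then have "((\<lambda>A. norm (sum ?f A)) \<longlongrightarrow> norm (F x y)) (finite_subsets_at_top S)" by (rule tendsto_norm)
    moreover have "\<forall>\<^sub>F A in finite_subsets_at_top S. norm (sum ?f A) \<le> (\<Sum>\<^sub>\<infinity>n\<in>S. g n + h n)"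
    proof (rule eventually_finite_subsets_at_top_weakI)
      fix A assume A: "finite A" "A \<subseteq> S"
      have "norm (sum ?f A) \<le> (\<Sum>n\<in>A. g n + h n)" by (intro sum_norm_le summand y) (use A in auto)
      also have "\<dots> \<le> (\<Sum>\<^sub>\<infinity>n\<in>S. g n + h n)"
        by (rule finite_sum_le_infsum[OF gh A]) (simp add: g0 h0)
      finally show "norm (sum ?f A) \<le> (\<Sum>\<^sub>\<infinity>n\<in>S. g n + h n)" .
    qed
    ultimately show ?thesis by (rule tendsto_upperbound) simp
  qed
  then show ?thesis by (intro exI[of _ "\<Sum>\<^sub>\<infinity>n\<in>S. g n + h n"] allI impI)
qed

text \<open>The coefficients bound the form near the cusp, invariance carries this bound down to the
  real axis, and there heights a/Y with large Y give back sharp information on the coefficients. On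
  the window [a, 3 a] the lower bound is weakest at 3 a, whence exp(-60 a).\<close>

lemma modular_expansion_bounds:
  fixes \<kappa> :: "real \<Rightarrow> complex" and \<rho> :: "int \<Rightarrow> complex"
  assumes mod: "modular_of_weight k f"
    and expansion: "\<And>x y. y > 0 \<Longrightarrow>
      ((\<lambda>n. of_real (sqrt y) * \<rho> n * \<kappa> (\<bar>of_int n\<bar> * y) * cis (2 * pi * (of_int n * x))) has_sum
        (of_real (y powr (real_of_int k / 2)) * f (Complex x y))) S"
    and S: "0 \<notin> S" "{1..} \<subseteq> S" and kernel: "exponential_kernel \<kappa>"
  shows "additive_twists_bounded (\<lambda>n. \<rho> (int n)) \<and> mean_square_bounded (\<lambda>n. \<rho> (int n))"
proof -
  let ?F = "\<lambda>x y. of_real (y powr (real_of_int k / 2)) * f (Complex x y)"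
  obtain B where B: "\<forall>x y. y \<ge> 1 / 5 \<longrightarrow> norm (?F x y) \<le> B"
    using expansion_bounded_near_cusp[OF expansion S(1) kernel] by (rule exE)
  have cusp: "Im z powr (real_of_int k / 2) * norm (f z) \<le> B" if "Im z \<ge> 1 / 5" for z
    using B[rule_format, OF that, of "Re z"] by (simp add: norm_mult)
  have bounded: "norm (?F x y) \<le> B" if y: "y > 0" for x y
    using modular_bounded_on_upper_half_plane[OF mod cusp, of "Complex x y"] y by (simp add: norm_mult)
  obtain a c where ac: "a > 0" "c > 0" "\<forall>u\<ge>a. c * exp (- (20 * u)) \<le> norm (\<kappa> u)"
    using kernel unfolding exponential_kernel_def by blast
  obtain \<Lambda> where \<Lambda>: "\<Lambda> \<ge> 0" "\<forall>u\<in>{a..3 * a}. \<forall>v\<in>{a..3 * a}. norm (\<kappa> u - \<kappa> v) \<le> \<Lambda> * \<bar>u - v\<bar>"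
    using kernel ac(1) unfolding exponential_kernel_def by blast
  have lower: "c * exp (- (60 * a)) \<le> norm (\<kappa> u)" if "u \<in> {a..3 * a}" for u
  proof -
    have "c * exp (- (60 * a)) \<le> c * exp (- (20 * u))" using that ac by simp
    also have "\<dots> \<le> norm (\<kappa> u)" using ac(3) that by simp
    finally show ?thesis .
  qed
  have c0: "c * exp (- (60 * a)) > 0" using ac by simp
  show ?thesis
    using expansion_imp_additive_twists_bounded[OF expansion bounded S(2) ac(1) c0 \<Lambda>(1) lower \<Lambda>(2)[rule_format]]
      expansion_imp_mean_square_bounded[OF expansion bounded S(2) ac(1) c0 \<Lambda>(1) lower \<Lambda>(2)[rule_format]]
    by blast
qed

section \<open>The Bessel kernel\<close>

text \<open>The mean of exp t >= 1 + t + t^2/2 and exp(-t) >= 1 - t. The constant 1 will produce the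
  decay in y, the square the convergence in t.\<close>

lemma cosh_ge_quadratic: "1 + t\<^sup>2 / 4 \<le> cosh t" if "t \<ge> 0" for t :: real
  using exp_lower_Taylor_quadratic[OF that] exp_ge_add_one_self[of "- t"] by (simp add: cosh_field_def)

text \<open>Completing the square gives (r + 1) t <= (r + 1)^2 / a + a t^2 / 4, and the quadratic
  part of y cosh t pays for the last term. The extra 1 in r + 1 is what leaves the integrable factor
  exp(-t).\<close>

lemma exp_neg_cosh_le:
  fixes a y r t :: real
  assumes "0 < a" "a \<le> y" "0 \<le> t"
  shows "exp (- y * cosh t + r * t) \<le> exp ((r + 1)\<^sup>2 / a) * exp (- y) * exp (- t)"
proof -
  have "y * (1 + t\<^sup>2 / 4) \<le> y * cosh t"
    using assms by (intro mult_left_mono cosh_ge_quadratic) auto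
  moreover have "a * (t\<^sup>2 / 4) \<le> y * (t\<^sup>2 / 4)" using assms by (intro mult_right_mono) auto
  moreover have "(r + 1) * t \<le> (r + 1)\<^sup>2 / a + a * (t\<^sup>2 / 4)"
  proof -
    have "(r + 1)\<^sup>2 / a + a * (t\<^sup>2 / 4) - (r + 1) * t = ((r + 1) - a * t / 2)\<^sup>2 / a"
      using assms by (simp add: field_simps power2_eq_square)
    also have "\<dots> \<ge> 0" using assms by simp
    finally show ?thesis by simp
  qed
  ultimately have "- y * cosh t + r * t \<le> (r + 1)\<^sup>2 / a + - y + - t" by (simp add: algebra_simps)
  then show ?thesis by (simp only: exp_add[symmetric] exp_le_cancel_iff)
qed

lemma norm_cosh_le:
  fixes w :: complex and t :: real
  assumes "t \<ge> 0"
  shows "norm (cosh (w * of_real t)) \<le> exp (norm w * t)"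
proof -
  have e: "norm (exp z) \<le> exp (norm z)" for z :: complex by (rule norm_exp)
  have "norm (cosh (w * of_real t)) \<le> (norm (exp (w * of_real t)) + norm (exp (- (w * of_real t)))) / 2"
    unfolding cosh_field_def norm_divide
    using norm_triangle_ineq[of "exp (w * of_real t)" "exp (- (w * of_real t))"] by simp
  also have "\<dots> \<le> (exp (norm w * t) + exp (norm w * t)) / 2"
  proof (intro divide_right_mono add_mono)
    show "norm (exp (w * of_real t)) \<le> exp (norm w * t)" "norm (exp (- (w * of_real t))) \<le> exp (norm w * t)"
      using e[of "w * of_real t"] e[of "- (w * of_real t)"] assms
      by (simp_all only: norm_minus_cancel norm_mult norm_of_real abs_of_nonneg)
  qed simp
  finally show ?thesis by simp
qed

lemma has_integral_exp_decay: "((\<lambda>t::real. C * exp (- t)) has_integral C) {0..}"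
  using has_integral_mult_right[OF has_integral_exp_minus_to_infinity[of 1 0], of C] by simp

lemma integral_exp_decay_bound:
  fixes f :: "real \<Rightarrow> complex"
  assumes f: "continuous_on {0..} f" and b: "\<And>t. t \<ge> 0 \<Longrightarrow> norm (f t) \<le> C * exp (- t)"
  shows "f integrable_on {0..}" "norm (integral {0..} f) \<le> C"
proof -
  have meas: "f \<in> borel_measurable (lebesgue_on {0..})"
    using f by (intro continuous_imp_measurable_on_sets_lebesgue) auto
  show int: "f integrable_on {0..}"
    by (rule measurable_bounded_by_integrable_imp_integrable[OF meas has_integral_integrable[OF has_integral_exp_decay[of C]]])
      (use b in auto)
  show "norm (integral {0..} f) \<le> C"
    by (rule integral_norm_bound_integral'[OF _ meas _ has_integral_exp_decay[of C]]) (use b in auto)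
qed

context
  fixes w :: complex
begin

definition bessel_integrand :: "real \<Rightarrow> real \<Rightarrow> complex" where
  "bessel_integrand y t = of_real (exp (- y * cosh t)) * cosh (w * of_real t)"

lemma bessel_K_eq: "bessel_K w y = integral {0..} (bessel_integrand y)"
  by (simp add: bessel_K_def bessel_integrand_def[abs_def])

lemma continuous_bessel_integrand: "continuous_on {0..} (bessel_integrand y)"
  unfolding bessel_integrand_def[abs_def] by (intro continuous_intros)

lemma norm_bessel_integrand_le:
  assumes "0 < a" "a \<le> y" "0 \<le> t"
  shows "norm (bessel_integrand y t) \<le> (exp ((norm w + 1)\<^sup>2 / a) * exp (- y)) * exp (- t)"
proof -
  have "norm (bessel_integrand y t) \<le> exp (- y * cosh t) * exp (norm w * t)"
    unfolding bessel_integrand_def norm_mult using norm_cosh_le[OF assms(3)] by simp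
  also have "\<dots> = exp (- y * cosh t + norm w * t)" by (simp only: exp_add)
  also have "\<dots> \<le> (exp ((norm w + 1)\<^sup>2 / a) * exp (- y)) * exp (- t)" by (rule exp_neg_cosh_le[OF assms])
  finally show ?thesis .
qed

lemma integrable_bessel_integrand: "y > 0 \<Longrightarrow> bessel_integrand y integrable_on {0..}"
  by (rule integral_exp_decay_bound(1)[OF continuous_bessel_integrand norm_bessel_integrand_le[of y y]]) auto

lemma norm_bessel_K_le:
  assumes "0 < a" "a \<le> y"
  shows "norm (bessel_K w y) \<le> exp ((norm w + 1)\<^sup>2 / a) * exp (- y)"
  unfolding bessel_K_eq
  by (rule integral_exp_decay_bound(2)[OF continuous_bessel_integrand norm_bessel_integrand_le[OF assms]])

text \<open>The mean value estimate is applied to the integrand in y. It costs a factor cosh t <=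
  exp t, which raises the exponent from |w| to |w| + 1 and so the constant to (|w| + 2)^2.\<close>

lemma bessel_K_lipschitz:
  assumes "0 < a" "a \<le> x" "a \<le> y"
  shows "norm (bessel_K w x - bessel_K w y) \<le> exp ((norm w + 2)\<^sup>2 / a) * \<bar>x - y\<bar>"
proof -
  have pos: "x > 0" "y > 0" using assms by auto
  have exp_diff: "\<bar>exp (- p) - exp (- q)\<bar> \<le> exp (- m) * \<bar>p - q\<bar>" if "m \<le> p" "m \<le> q" for m p q :: real
  proof -
    have *: "\<bar>exp (- p) - exp (- q)\<bar> \<le> exp (- m) * \<bar>p - q\<bar>" if "p \<le> q" "m \<le> p" for p q :: real
    proof -
      have "exp (- p) - exp (- q) = exp (- p) * (1 - exp (- (q - p)))"
        by (simp add: algebra_simps exp_add[symmetric])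
      also have "\<dots> \<le> exp (- p) * (q - p)"
      proof (rule mult_left_mono)
        show "1 - exp (- (q - p)) \<le> q - p" using exp_ge_add_one_self[of "- (q - p)"] by linarith
      qed simp
      also have "\<dots> \<le> exp (- m) * (q - p)" using that by (intro mult_right_mono) auto
      finally show ?thesis using that by simp
    qed
    show ?thesis using *[of p q] *[of q p] that by (cases "p \<le> q") (auto simp: abs_minus_commute)
  qed
  have "bessel_K w x - bessel_K w y = integral {0..} (\<lambda>t. bessel_integrand x t - bessel_integrand y t)"
    unfolding bessel_K_eq by (rule integral_diff[symmetric]) (intro integrable_bessel_integrand pos)+
  also have "norm \<dots> \<le> exp ((norm w + 2)\<^sup>2 / a) * \<bar>x - y\<bar>"
  proof (rule integral_exp_decay_bound(2))
    show "continuous_on {0..} (\<lambda>t. bessel_integrand x t - bessel_integrand y t)"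
      by (intro continuous_on_diff continuous_bessel_integrand)
    fix t :: real assume t: "t \<ge> 0"
    have c1: "1 \<le> cosh t" by (rule cosh_real_ge_1)
    have c2: "cosh t \<le> exp t" using t by (simp add: cosh_field_def)
    have "norm (bessel_integrand x t - bessel_integrand y t) = \<bar>exp (- (x * cosh t)) - exp (- (y * cosh t))\<bar> * norm (cosh (w * of_real t))"
      by (simp add: bessel_integrand_def left_diff_distrib[symmetric] of_real_diff[symmetric] norm_mult del: of_real_diff)
    also have "\<dots> \<le> (exp (- (a * cosh t)) * \<bar>x * cosh t - y * cosh t\<bar>) * exp (norm w * t)"
      using assms c1 by (intro mult_mono exp_diff norm_cosh_le t mult_right_mono) auto
    also have "\<bar>x * cosh t - y * cosh t\<bar> = \<bar>x - y\<bar> * cosh t"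
      using c1 by (simp add: left_diff_distrib[symmetric] abs_mult)
    also have "(exp (- (a * cosh t)) * (\<bar>x - y\<bar> * cosh t)) * exp (norm w * t)
        \<le> (exp (- (a * cosh t)) * (\<bar>x - y\<bar> * exp t)) * exp (norm w * t)"
      using c2 by (intro mult_right_mono mult_left_mono) auto
    also have "\<dots> = \<bar>x - y\<bar> * (exp (- (a * cosh t)) * exp t * exp (norm w * t))"
      by (simp only: mult_ac)
    also have "exp (- (a * cosh t)) * exp t * exp (norm w * t) = exp (- a * cosh t + (norm w + 1) * t)"
      by (simp add: exp_add[symmetric] distrib_right add_ac)
    also have "\<bar>x - y\<bar> * exp (- a * cosh t + (norm w + 1) * t) \<le> \<bar>x - y\<bar> * (exp ((norm w + 1 + 1)\<^sup>2 / a) * exp (- a) * exp (- t))"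
      by (intro mult_left_mono exp_neg_cosh_le assms t) auto
    also have "\<dots> \<le> \<bar>x - y\<bar> * (exp ((norm w + 1 + 1)\<^sup>2 / a) * 1 * exp (- t))"
      using assms by (intro mult_left_mono mult_right_mono) auto
    finally show "norm (bessel_integrand x t - bessel_integrand y t) \<le> exp ((norm w + 2)\<^sup>2 / a) * \<bar>x - y\<bar> * exp (- t)"
      by (simp add: mult_ac add_ac)
  qed
  finally show ?thesis .
qed

text \<open>For large \<open>y\<close> the integral is dominated by a neighbourhood \<open>[0, b]\<close> of \<open>0\<close>, where \<open>cosh (w t)\<close>
  has real part at least \<open>1 / 2\<close>.\<close>
lemma bessel_K_lower_bound: "\<exists>Y>0. \<exists>c>0. \<forall>y\<ge>Y. c * exp (- (2 * y)) \<le> norm (bessel_K w y)"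
proof -
  have "((\<lambda>t::real. cosh (w * of_real t)) \<longlongrightarrow> cosh (w * of_real 0)) (at 0)"
    by (intro tendsto_intros)
  then have "\<forall>\<^sub>F t::real in at 0. dist (cosh (w * of_real t)) 1 < 1 / 2"
    by (intro tendstoD) simp_all
  then obtain d where d: "d > 0" "\<forall>t. t \<noteq> 0 \<and> dist t 0 < d \<longrightarrow> dist (cosh (w * of_real t)) 1 < 1 / 2"
    unfolding eventually_at by auto
  define b where "b = min (d / 2) 1"
  \<comment> \<open>Then cosh a < cosh b, so the main term, of size exp(- y cosh a) from [0, a],
    outgrows the tail beyond b, of size exp(- y cosh b). Between a and b positivity of the real part
    is enough.\<close>
  define a where "a = b / 2"
  have b: "0 < b" "b < d" "b \<le> 1" and a: "0 < a" "a < b" using d by (auto simp: b_def a_def)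
  have Re: "1 / 2 \<le> Re (cosh (w * of_real t))" if "0 \<le> t" "t \<le> b" for t
  proof (cases "t = 0")
    case False
    then have "norm (cosh (w * of_real t) - 1) < 1 / 2" using d(2) that b by (simp add: dist_norm)
    then show ?thesis using abs_Re_le_cmod[of "cosh (w * of_real t) - 1"] by simp
  qed simp
  have cab: "cosh a < cosh b" using a by (intro cosh_real_strict_mono) auto
  \<comment> \<open>The origin of the rate 2 in the lower bound.\<close>
  have ca2: "cosh a \<le> 2"
  proof -
    have "cosh a \<le> exp a" using a by (simp add: cosh_field_def)
    also have "\<dots> \<le> exp (1 / 2)" using a b by (simp add: a_def)
    also have "\<dots> \<le> 2" by (rule exp_half_le2)
    finally show ?thesis .
  qed
  \<comment> \<open>Beyond b, one factor exp(- cosh t) is kept to absorb exp(|w| t), and the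
    remaining power y - 1 is bounded by its value at b. The factor exp(cosh b) rewrites exp(-(y - 1)
    cosh b) as a multiple of exp(- y cosh b).\<close>
  define M where "M = exp ((norm w + 1)\<^sup>2) * exp (cosh b)"
  have M0: "M > 0" by (simp add: M_def)
  have pointwise: "(if t \<in> {0..a} then exp (- (y * cosh a)) / 2 else 0) - (M * exp (- (y * cosh b))) * exp (- t) \<le> Re (bessel_integrand y t)"
    if t: "0 \<le> t" and y: "y \<ge> 1" for t y
  proof -
    have RB: "Re (bessel_integrand y t) = exp (- (y * cosh t)) * Re (cosh (w * of_real t))"
      by (simp add: bessel_integrand_def)
    have Mp: "(M * exp (- (y * cosh b))) * exp (- t) \<ge> 0" using M0 by simp
    show ?thesis
    proof (cases "t \<le> b")
      case True
      have r: "1 / 2 \<le> Re (cosh (w * of_real t))" by (rule Re[OF t True])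
      show ?thesis
      proof (cases "t \<le> a")
        case True
        have "exp (- (y * cosh a)) * (1 / 2) \<le> Re (bessel_integrand y t)"
          unfolding RB using r True t y by (intro mult_mono) (auto simp: cosh_real_nonneg_le_iff)
        then show ?thesis using True t Mp by simp
      next
        case False
        have "0 \<le> Re (bessel_integrand y t)" unfolding RB using r by simp
        then show ?thesis using False Mp by simp
      qed
    next
      case False
      have "\<bar>Re (bessel_integrand y t)\<bar> \<le> exp (- (y * cosh t)) * exp (norm w * t)"
        unfolding RB abs_mult
        using order_trans[OF abs_Re_le_cmod norm_cosh_le[OF t]] by simp
      also have "exp (- (y * cosh t)) = exp (- ((y - 1) * cosh t)) * exp (- 1 * cosh t)"
        by (simp add: exp_add[symmetric] algebra_simps)
      also have "exp (- ((y - 1) * cosh t)) * exp (- 1 * cosh t) * exp (norm w * t)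
          = exp (- ((y - 1) * cosh t)) * exp (- 1 * cosh t + norm w * t)" by (simp only: exp_add mult.assoc)
      also have "\<dots> \<le> exp (- ((y - 1) * cosh b)) * (exp ((norm w + 1)\<^sup>2 / 1) * exp (- 1) * exp (- t))"
      proof (intro mult_mono exp_neg_cosh_le)
        have "cosh b \<le> cosh t" using False b t by (simp add: cosh_real_nonneg_le_iff)
        then show "exp (- ((y - 1) * cosh b)) \<ge> exp (- ((y - 1) * cosh t))" using y by (simp add: mult_left_mono)
      qed (use t in auto)
      also have "\<dots> \<le> exp (- ((y - 1) * cosh b)) * (exp ((norm w + 1)\<^sup>2) * 1 * exp (- t))"
        by (intro mult_left_mono mult_right_mono) auto
      also have "\<dots> = (M * exp (- (y * cosh b))) * exp (- t)"
        by (simp add: M_def left_diff_distrib exp_diff exp_minus field_simps)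
      finally show ?thesis using False a by auto
    qed
  qed
  have lower: "a * (exp (- (y * cosh a)) / 2) - M * exp (- (y * cosh b)) \<le> norm (bessel_K w y)" if y: "y \<ge> 1" for y
  proof -
    have "((\<lambda>t. exp (- (y * cosh a)) / 2) has_integral (a * (exp (- (y * cosh a)) / 2))) {0..a}"
      using has_integral_const_real[of "exp (- (y * cosh a)) / 2" 0 a] a by simp
    then have "((\<lambda>t. if t \<in> {0..a} then exp (- (y * cosh a)) / 2 else 0) has_integral (a * (exp (- (y * cosh a)) / 2))) {0..}"
      by (subst has_integral_restrict) auto
    then have 1: "((\<lambda>t. (if t \<in> {0..a} then exp (- (y * cosh a)) / 2 else 0) - (M * exp (- (y * cosh b))) * exp (- t))
        has_integral (a * (exp (- (y * cosh a)) / 2) - M * exp (- (y * cosh b)))) {0..}"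
      by (rule has_integral_diff) (rule has_integral_exp_decay)
    have "(bessel_integrand y has_integral bessel_K w y) {0..}"
      unfolding bessel_K_eq using integrable_bessel_integrand[of y] y by (intro integrable_integral) auto
    then have 2: "((\<lambda>t. Re (bessel_integrand y t)) has_integral Re (bessel_K w y)) {0..}" by (rule has_integral_Re)
    have "a * (exp (- (y * cosh a)) / 2) - M * exp (- (y * cosh b)) \<le> Re (bessel_K w y)"
      by (rule has_integral_le[OF 1 2]) (use pointwise y in auto)
    then show ?thesis using complex_Re_le_cmod[of "bessel_K w y"] by linarith
  qed
  \<comment> \<open>From here on the tail is at most half of the main term a/2 * exp(- y cosh
    a).\<close>
  define Y where "Y = max 1 (ln (4 * M / a) / (cosh b - cosh a))"
  have "a / 4 * exp (- (2 * y)) \<le> norm (bessel_K w y)" if y: "y \<ge> Y" for y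
  proof -
    have y1: "y \<ge> 1" using y by (simp add: Y_def)
    have "ln (4 * M / a) / (cosh b - cosh a) \<le> y" using y by (simp add: Y_def)
    then have "ln (4 * M / a) \<le> y * (cosh b - cosh a)" using cab by (simp add: field_simps)
    then have "exp (ln (4 * M / a)) \<le> exp (y * cosh b - y * cosh a)" by (simp add: right_diff_distrib)
    then have "4 * M / a \<le> exp (y * cosh b - y * cosh a)" using M0 a by simp
    then have "M * exp (- (y * cosh b)) \<le> (a / 4 * exp (y * cosh b - y * cosh a)) * exp (- (y * cosh b))"
      using a by (intro mult_right_mono) (auto simp: field_simps)
    also have "\<dots> = a / 4 * exp (- (y * cosh a))" by (simp add: exp_add[symmetric])
    finally have "a / 4 * exp (- (y * cosh a)) \<le> norm (bessel_K w y)" using lower[OF y1] by linarith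
    moreover have "a / 4 * exp (- (2 * y)) \<le> a / 4 * exp (- (y * cosh a))"
      using a ca2 y1 by (intro mult_left_mono) auto
    ultimately show ?thesis by linarith
  qed
  then show ?thesis using a by (intro exI[of _ Y] conjI exI[of _ "a / 4"]) (auto simp: Y_def)
qed

text \<open>As 2 pi lies between 5 and 8, u >= 1/5 gives an argument of at least 1 with decay better
  than exp(-u), and the lower rate 2 becomes at most 16 in u.\<close>

lemma exponential_kernel_bessel_K: "exponential_kernel (\<lambda>u. bessel_K w (2 * pi * u))"
  unfolding exponential_kernel_def
proof (intro conjI allI impI)
  show "\<exists>C. \<forall>u\<ge>1 / 5. norm (bessel_K w (2 * pi * u)) \<le> C * exp (- u)"
  proof (intro exI allI impI)
    fix u :: real assume u: "u \<ge> 1 / 5"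
    have p: "5 * u \<le> 2 * pi * u" using u pi_gt3 by (intro mult_right_mono) auto
    have "norm (bessel_K w (2 * pi * u)) \<le> exp ((norm w + 1)\<^sup>2 / 1) * exp (- (2 * pi * u))"
    proof (rule norm_bessel_K_le)
      show "1 \<le> 2 * pi * u" using p u by linarith
    qed simp
    also have "\<dots> \<le> exp ((norm w + 1)\<^sup>2 / 1) * exp (- u)"
      using p u by (intro mult_left_mono) auto
    finally show "norm (bessel_K w (2 * pi * u)) \<le> exp ((norm w + 1)\<^sup>2 / 1) * exp (- u)" .
  qed
  obtain Y c where Yc: "Y > 0" "c > 0" "\<forall>y\<ge>Y. c * exp (- (2 * y)) \<le> norm (bessel_K w y)"
    using bessel_K_lower_bound by blast
  show "\<exists>a>0. \<exists>c>0. \<forall>u\<ge>a. c * exp (- (20 * u)) \<le> norm (bessel_K w (2 * pi * u))"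
  proof (rule exI[of _ Y], intro conjI Yc(1), rule exI[of _ c], intro conjI allI impI Yc(2))
    fix u assume u: "u \<ge> Y"
    have "1 * u \<le> 2 * pi * u" "2 * pi * u \<le> 8 * u" using u Yc(1) pi_gt3 pi_less_4 by (intro mult_right_mono; simp)+
    then have "c * exp (- (20 * u)) \<le> c * exp (- (2 * (2 * pi * u)))" "Y \<le> 2 * pi * u"
      using Yc(2) u by (auto intro: order_trans)
    then show "c * exp (- (20 * u)) \<le> norm (bessel_K w (2 * pi * u))" using Yc(3) by (meson order_trans)
  qed
  fix a :: real assume a: "a > 0"
  show "\<exists>\<Lambda>\<ge>0. \<forall>u\<in>{a..3 * a}. \<forall>v\<in>{a..3 * a}. norm (bessel_K w (2 * pi * u) - bessel_K w (2 * pi * v)) \<le> \<Lambda> * \<bar>u - v\<bar>"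
  proof (intro exI[of _ "exp ((norm w + 2)\<^sup>2 / (2 * pi * a)) * (2 * pi)"] conjI ballI)
    fix u v assume "u \<in> {a..3 * a}" "v \<in> {a..3 * a}"
    then have "norm (bessel_K w (2 * pi * u) - bessel_K w (2 * pi * v)) \<le> exp ((norm w + 2)\<^sup>2 / (2 * pi * a)) * \<bar>2 * pi * u - 2 * pi * v\<bar>"
      using a by (intro bessel_K_lipschitz) auto
    also have "\<bar>2 * pi * u - 2 * pi * v\<bar> = 2 * pi * \<bar>u - v\<bar>" by (simp add: right_diff_distrib[symmetric] abs_mult)
    finally show "norm (bessel_K w (2 * pi * u) - bessel_K w (2 * pi * v)) \<le> exp ((norm w + 2)\<^sup>2 / (2 * pi * a)) * (2 * pi) * \<bar>u - v\<bar>"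
      by (simp add: mult_ac)
  qed simp
qed

end

section \<open>Averaged triple correlations\<close>

lemma smooth_bump_deriv:
  assumes "smooth_bump {a..b} V"
  shows "smooth_bump {a..b} (deriv V)"
  unfolding smooth_bump_def
proof (intro conjI allI impI)
  fix j x
  show "(deriv ^^ j) (deriv V) differentiable at x"
  proof -
    have "(deriv ^^ Suc j) V differentiable at x" using assms unfolding smooth_bump_def by blast
    then show ?thesis by (simp only: funpow_Suc_right comp_apply)
  qed
next
  fix x :: real assume "x \<notin> {a..b}"
  moreover have "\<And>y. y \<in> - {a..b} \<Longrightarrow> V y = 0" using assms by (auto simp: smooth_bump_def)
  moreover have "open (- {a..b})" by (simp add: open_Compl)
  ultimately have "(V has_field_derivative 0) (at x)"
    by (intro has_field_derivative_transform_within_open[of "\<lambda>_. 0" 0 x "- {a..b}" V]) auto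
  then show "deriv V x = 0" by (rule DERIV_imp_deriv)
qed

lemma smooth_bump_has_deriv:
  assumes "smooth_bump S V"
  shows "(V has_field_derivative deriv V x) (at x)"
proof -
  have "(deriv ^^ 0) V differentiable at x" using assms unfolding smooth_bump_def by blast
  then show ?thesis by (simp add: DERIV_deriv_iff_real_differentiable)
qed

lemma smooth_bump_bounded:
  assumes "smooth_bump {a..b} V"
  shows "\<exists>M\<ge>0. \<forall>x. \<bar>V x\<bar> \<le> M"
proof -
  have "continuous_on {a..b} V"
    by (rule DERIV_continuous_on[OF has_field_derivative_at_within[OF smooth_bump_has_deriv[OF assms]]])
  then have "bounded (V ` {a..b})" by (intro compact_imp_bounded compact_continuous_image) auto
  then obtain M where M: "\<forall>x\<in>{a..b}. \<bar>V x\<bar> \<le> M" by (auto simp: bounded_iff)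
  have "\<bar>V x\<bar> \<le> max M 0" for x
    using bspec[OF M, of x] assms by (cases "x \<in> {a..b}") (auto simp: smooth_bump_def)
  then show ?thesis by (intro exI[of _ "max M 0"]) simp
qed

lemma smooth_bump_lipschitz:
  assumes "smooth_bump {a..b} V"
  shows "\<exists>M\<ge>0. \<forall>x y. \<bar>V x - V y\<bar> \<le> M * \<bar>x - y\<bar>"
proof -
  obtain M where M: "M \<ge> 0" "\<forall>x. \<bar>deriv V x\<bar> \<le> M"
    using smooth_bump_bounded[OF smooth_bump_deriv[OF assms]] by blast
  have "\<bar>V x - V y\<bar> \<le> M * \<bar>x - y\<bar>" for x y
    using field_differentiable_bound[of UNIV V "deriv V" M x y] smooth_bump_has_deriv[OF assms] M by simp
  then show ?thesis using M(1) by blast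
qed

text \<open>The second difference is the increment of x -> V(x + s) - V(x) over a step s, and the
  derivative of this function is O(|s|) because V' is Lipschitz.\<close>

lemma smooth_bump_second_difference:
  assumes "smooth_bump {a..b} V"
  shows "\<exists>M\<ge>0. \<forall>x s. \<bar>V (x + s) - 2 * V x + V (x - s)\<bar> \<le> M * s\<^sup>2"
proof -
  obtain M where M: "M \<ge> 0" "\<forall>x y. \<bar>deriv V x - deriv V y\<bar> \<le> M * \<bar>x - y\<bar>"
    using smooth_bump_lipschitz[OF smooth_bump_deriv[OF assms]] by blast
  have "\<bar>V (x + s) - 2 * V x + V (x - s)\<bar> \<le> M * s\<^sup>2" for x s
  proof -
    define f where "f = (\<lambda>x. V (x + s) - V x)"
    have "((\<lambda>x. V (x + s)) has_field_derivative deriv V (x + s)) (at x)" for x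
      using smooth_bump_has_deriv[OF assms, of "x + s"] by (simp only: DERIV_shift)
    then have f: "(f has_field_derivative deriv V (x + s) - deriv V x) (at x)" for x
      unfolding f_def by (rule DERIV_diff[OF _ smooth_bump_has_deriv[OF assms]])
    have "norm (f x - f (x - s)) \<le> (M * \<bar>s\<bar>) * norm (x - (x - s))"
    proof (rule field_differentiable_bound[OF convex_UNIV f])
      fix z show "norm (deriv V (z + s) - deriv V z) \<le> M * \<bar>s\<bar>" using M(2)[rule_format, of "z + s" z] by simp
    qed simp_all
    then show ?thesis by (simp add: f_def algebra_simps power2_eq_square)
  qed
  then show ?thesis using M(1) by blast
qed

text \<open>A discrete Taylor formula: v is a combination of the hinge functions max (h - j) 0 with
  its second differences as coefficients. The two zero values are the initial conditions; for the
  weight they hold since V vanishes on (-\<infinity>, 0].\<close>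

lemma second_summation:
  fixes v :: "real \<Rightarrow> real"
  assumes "v 0 = 0" "v (-1) = 0"
  shows "v (real h) = (\<Sum>j<h. (v (real j + 1) - 2 * v (real j) + v (real j - 1)) * (real h - real j))"
proof -
  define D where "D = (\<lambda>j::nat. v (real j + 1) - 2 * v (real j) + v (real j - 1))"
  have 1: "(\<Sum>j<h. D j) = v (real h) - v (real h - 1)" for h
    by (induction h) (simp_all add: assms D_def algebra_simps)
  have "v (real h) = (\<Sum>j<h. D j * (real h - real j))"
  proof (induction h)
    case (Suc h)
    have "(\<Sum>j<Suc h. D j * (real (Suc h) - real j)) = (\<Sum>j<h. D j * (real h - real j)) + (\<Sum>j<Suc h. D j)"
      by (simp add: sum.distrib[symmetric] algebra_simps)
    then show ?case using Suc 1[of "Suc h"] by simp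
  qed (simp add: assms)
  then show ?thesis by (simp add: D_def)
qed

text \<open>The point of this decomposition is that each summand depends on \<open>n\<close> and \<open>m\<close> through separate
  conditions, so no smoothness has to be carried into the circle method.\<close>
lemma weight_separation:
  fixes V :: "real \<Rightarrow> real" and n m b e J :: nat
  assumes V: "\<And>x. x \<le> 0 \<Longrightarrow> V x = 0" and H: "H > 0"
    and nm: "b \<le> n" "n < m" "m \<le> e" "m - n \<le> J"
  shows "V (real (m - n) / H) = (\<Sum>j<J. \<Sum>t\<in>{b..<e}.
     if n \<le> t \<and> t + j < m then V ((real j + 1) / H) - 2 * V (real j / H) + V ((real j - 1) / H) else 0)"
proof -
  define D where "D = (\<lambda>j::nat. V ((real j + 1) / H) - 2 * V (real j / H) + V ((real j - 1) / H))"
  have "V (real (m - n) / H) = (\<Sum>j<m - n. D j * (real (m - n) - real j))"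
    unfolding D_def using second_summation[of "\<lambda>x. V (x / H)" "m - n"] V H by (simp add: divide_le_0_iff)
  also have "\<dots> = (\<Sum>j<m - n. D j * real (m - n - j))"
    by (intro sum.cong refl) (simp add: of_nat_diff)
  \<comment> \<open>Truncated subtraction makes the hinge vanish for j >= m - n, so the range of j
    can be made independent of n and m.\<close>
  also have "\<dots> = (\<Sum>j<J. D j * real (m - n - j))"
    using nm by (intro sum.mono_neutral_left) auto
  \<comment> \<open>The hinge m - n - j is the number of integers t with n <= t < m - j.\<close>
  also have "\<dots> = (\<Sum>j<J. \<Sum>t\<in>{b..<e}. if n \<le> t \<and> t + j < m then D j else 0)"
  proof (intro sum.cong refl)
    fix j
    have "{t \<in> {b..<e}. n \<le> t \<and> t + j < m} = {n..<m - j}" using nm by auto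
    then have "(\<Sum>t\<in>{b..<e}. if n \<le> t \<and> t + j < m then D j else 0) = real (card {n..<m - j}) * D j"
      by (simp add: sum.inter_filter[symmetric])
    moreover have "m - j - n = m - n - j" by simp
    ultimately show "D j * real (m - n - j) = (\<Sum>t\<in>{b..<e}. if n \<le> t \<and> t + j < m then D j else 0)"
      by (simp add: mult.commute)
  qed
  finally show ?thesis unfolding D_def .
qed

text \<open>For fixed (j, t) the weight is the constant second difference, of size at most M / H^2,
  and the circle method applies to n <= t and m > t + j. There are (4 L)^2 pairs, each costing S/2
  times the mean squares, which gives the factor 8 L^2 M / H^2.\<close>

lemma triple_correlation_block:
  fixes \<beta> \<mu> \<omega> :: "nat \<Rightarrow> complex" and V :: "real \<Rightarrow> real" and L b :: nat
  assumes V: "smooth_bump {1..2} V"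
    and M: "M \<ge> 0" "\<And>x s. \<bar>V (x + s) - 2 * V x + V (x - s)\<bar> \<le> M * s\<^sup>2"
    and H: "H > 0" "H \<le> real L"
    and S: "\<And>t \<alpha>. norm (\<Sum>n\<in>{b..<b + L} \<inter> {..t}. \<beta> n * cis (2 * pi * (real n * \<alpha>))) \<le> S"
  shows "norm (\<Sum>n\<in>{b..<b + L}. \<Sum>h | 1 \<le> h \<and> real h \<le> 2 * H. of_real (V (real h / H)) * (\<beta> n * \<mu> (n + h) * \<omega> (n + 2 * h)))
     \<le> 8 * (real L)\<^sup>2 * (M / H\<^sup>2) * S * ((\<Sum>m\<in>{b<..b + 8 * L}. (norm (\<mu> m))\<^sup>2) + (\<Sum>m\<in>{b<..b + 8 * L}. (norm (\<omega> m))\<^sup>2))"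
proof -
  \<comment> \<open>As h <= 2 H <= 2 L, all m = n + h lie below b + 3 L < e. For n >= b and m <= e
    one has l = 2 m - n <= b + 8 L, which fixes the window of the mean squares.\<close>
  define e where "e = b + 4 * L"
  define D where "D = (\<lambda>j::nat. V ((real j + 1) / H) - 2 * V (real j / H) + V ((real j - 1) / H))"
  define Q where "Q = (\<Sum>m\<in>{b<..b + 8 * L}. (norm (\<mu> m))\<^sup>2) + (\<Sum>m\<in>{b<..b + 8 * L}. (norm (\<omega> m))\<^sup>2)"
  define R where "R = (\<lambda>j t. \<Sum>n\<in>{b..<b + L} \<inter> {..t}. \<Sum>m\<in>{t + j<..e}. \<Sum>l\<in>{b<..b + 8 * L}.
      if n + l = 2 * m then \<beta> n * \<mu> m * \<omega> l else 0)"
  have S0: "S \<ge> 0" using order_trans[OF norm_ge_zero S] .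
  have V0: "V x = 0" if "x \<le> 0" for x using smooth_bump_eq_0[OF V] that by simp
  have shift: "(\<Sum>h | 1 \<le> h \<and> real h \<le> 2 * H. of_real (V (real h / H)) * (\<beta> n * \<mu> (n + h) * \<omega> (n + 2 * h)))
     = (\<Sum>m\<in>{n<..e}. of_real (V (real (m - n) / H)) * (\<beta> n * \<mu> m * \<omega> (2 * m - n)))" if n: "n \<in> {b..<b + L}" for n
  proof -
    have "(\<Sum>h | 1 \<le> h \<and> real h \<le> 2 * H. of_real (V (real h / H)) * (\<beta> n * \<mu> (n + h) * \<omega> (n + 2 * h)))
      = (\<Sum>h\<in>{1..e - n}. of_real (V (real h / H)) * (\<beta> n * \<mu> (n + h) * \<omega> (n + 2 * h)))"
    proof (rule sum.mono_neutral_left)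
      show "{h. 1 \<le> h \<and> real h \<le> 2 * H} \<subseteq> {1..e - n}"
      proof
        fix h :: nat assume "h \<in> {h. 1 \<le> h \<and> real h \<le> 2 * H}"
        then have "1 \<le> h" "real h \<le> real (2 * L)" using H(2) by auto
        then show "h \<in> {1..e - n}" using n by (auto simp: e_def)
      qed
      show "\<forall>h\<in>{1..e - n} - {h. 1 \<le> h \<and> real h \<le> 2 * H}. of_real (V (real h / H)) * (\<beta> n * \<mu> (n + h) * \<omega> (n + 2 * h)) = 0"
      proof
        fix h assume "h \<in> {1..e - n} - {h. 1 \<le> h \<and> real h \<le> 2 * H}"
        then have "real h / H > 2" using H(1) by (auto simp: field_simps)
        then have "V (real h / H) = 0" using V by (auto simp: smooth_bump_def)
        then show "of_real (V (real h / H)) * (\<beta> n * \<mu> (n + h) * \<omega> (n + 2 * h)) = 0" by simp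
      qed
    qed simp
    also have "\<dots> = (\<Sum>m\<in>{n<..e}. of_real (V (real (m - n) / H)) * (\<beta> n * \<mu> m * \<omega> (2 * m - n)))"
      by (rule sum.reindex_bij_witness[of _ "\<lambda>m. m - n" "\<lambda>h. n + h"]) auto
    finally show ?thesis .
  qed
  have "(\<Sum>n\<in>{b..<b + L}. \<Sum>h | 1 \<le> h \<and> real h \<le> 2 * H. of_real (V (real h / H)) * (\<beta> n * \<mu> (n + h) * \<omega> (n + 2 * h)))
    = (\<Sum>n\<in>{b..<b + L}. \<Sum>m\<in>{n<..e}. \<Sum>j<4 * L. \<Sum>t\<in>{b..<e}.
        of_real (D j) * (if n \<le> t \<and> t + j < m then \<beta> n * \<mu> m * \<omega> (2 * m - n) else 0))"
  proof (rule sum.cong[OF refl], subst shift, assumption, rule sum.cong[OF refl])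
    fix n m assume n: "n \<in> {b..<b + L}" and m: "m \<in> {n<..e}"
    have *: "V (real (m - n) / H) = (\<Sum>j<4 * L. \<Sum>t\<in>{b..<e}. if n \<le> t \<and> t + j < m then D j else 0)"
      unfolding D_def by (rule weight_separation[OF V0 H(1)]) (use n m in \<open>auto simp: e_def\<close>)
    show "of_real (V (real (m - n) / H)) * (\<beta> n * \<mu> m * \<omega> (2 * m - n)) = (\<Sum>j<4 * L. \<Sum>t\<in>{b..<e}.
        of_real (D j) * (if n \<le> t \<and> t + j < m then \<beta> n * \<mu> m * \<omega> (2 * m - n) else 0))"
      unfolding * of_real_sum sum_distrib_right by (intro sum.cong refl) auto
  qed
  also have "\<dots> = (\<Sum>n\<in>{b..<b + L}. \<Sum>j<4 * L. \<Sum>m\<in>{n<..e}. \<Sum>t\<in>{b..<e}.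
        of_real (D j) * (if n \<le> t \<and> t + j < m then \<beta> n * \<mu> m * \<omega> (2 * m - n) else 0))"
    by (intro sum.cong refl sum.swap)
  also have "\<dots> = (\<Sum>j<4 * L. \<Sum>n\<in>{b..<b + L}. \<Sum>m\<in>{n<..e}. \<Sum>t\<in>{b..<e}.
        of_real (D j) * (if n \<le> t \<and> t + j < m then \<beta> n * \<mu> m * \<omega> (2 * m - n) else 0))"
    by (rule sum.swap)
  also have "\<dots> = (\<Sum>j<4 * L. \<Sum>n\<in>{b..<b + L}. \<Sum>t\<in>{b..<e}. \<Sum>m\<in>{n<..e}.
        of_real (D j) * (if n \<le> t \<and> t + j < m then \<beta> n * \<mu> m * \<omega> (2 * m - n) else 0))"
    by (intro sum.cong refl sum.swap)
  also have "\<dots> = (\<Sum>j<4 * L. \<Sum>t\<in>{b..<e}. \<Sum>n\<in>{b..<b + L}. \<Sum>m\<in>{n<..e}.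
        of_real (D j) * (if n \<le> t \<and> t + j < m then \<beta> n * \<mu> m * \<omega> (2 * m - n) else 0))"
    by (intro sum.cong refl sum.swap)
  also have "\<dots> = (\<Sum>j<4 * L. \<Sum>t\<in>{b..<e}. of_real (D j) * R j t)"
  proof (intro sum.cong refl)
    fix j t
    have "(\<Sum>n\<in>{b..<b + L}. \<Sum>m\<in>{n<..e}. if n \<le> t \<and> t + j < m then \<beta> n * \<mu> m * \<omega> (2 * m - n) else 0)
      = (\<Sum>n\<in>{b..<b + L} \<inter> {..t}. \<Sum>m\<in>{n<..e}. if n \<le> t \<and> t + j < m then \<beta> n * \<mu> m * \<omega> (2 * m - n) else 0)"
      by (rule sum.mono_neutral_right) (auto intro!: sum.neutral)
    also have "\<dots> = (\<Sum>n\<in>{b..<b + L} \<inter> {..t}. \<Sum>m\<in>{t + j<..e}. \<beta> n * \<mu> m * \<omega> (2 * m - n))"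
    proof (rule sum.cong[OF refl])
      fix n assume "n \<in> {b..<b + L} \<inter> {..t}"
      then show "(\<Sum>m\<in>{n<..e}. if n \<le> t \<and> t + j < m then \<beta> n * \<mu> m * \<omega> (2 * m - n) else 0)
         = (\<Sum>m\<in>{t + j<..e}. \<beta> n * \<mu> m * \<omega> (2 * m - n))"
        by (intro sum.mono_neutral_cong_right) auto
    qed
    \<comment> \<open>Reintroducing l as a free variable bound to n and m by n + l = 2 m gives the
      form in which the circle method detects it.\<close>
    also have "\<dots> = R j t"
      unfolding R_def
    proof (intro sum.cong refl)
      fix n m assume n: "n \<in> {b..<b + L} \<inter> {..t}" and m: "m \<in> {t + j<..e}"
      have "2 * m - n \<in> {b<..b + 8 * L}" using n m by (auto simp: e_def)
      moreover have "n + l = 2 * m \<longleftrightarrow> l = 2 * m - n" for l using n m by auto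
      ultimately show "\<beta> n * \<mu> m * \<omega> (2 * m - n) = (\<Sum>l\<in>{b<..b + 8 * L}. if n + l = 2 * m then \<beta> n * \<mu> m * \<omega> l else 0)"
        by simp
    qed
    finally show "(\<Sum>n\<in>{b..<b + L}. \<Sum>m\<in>{n<..e}. of_real (D j) * (if n \<le> t \<and> t + j < m then \<beta> n * \<mu> m * \<omega> (2 * m - n) else 0))
       = of_real (D j) * R j t"
      by (simp only: sum_distrib_left[symmetric])
  qed
  finally have eq: "(\<Sum>n\<in>{b..<b + L}. \<Sum>h | 1 \<le> h \<and> real h \<le> 2 * H. of_real (V (real h / H)) * (\<beta> n * \<mu> (n + h) * \<omega> (n + 2 * h)))
    = (\<Sum>j<4 * L. \<Sum>t\<in>{b..<e}. of_real (D j) * R j t)" .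
  have "norm (\<Sum>j<4 * L. \<Sum>t\<in>{b..<e}. of_real (D j) * R j t) \<le> (\<Sum>j<4 * L. \<Sum>t\<in>{b..<e}. (M / H\<^sup>2) * (S / 2 * Q))"
  proof (intro sum_norm_le)
    fix j t
    have "\<bar>D j\<bar> \<le> M / H\<^sup>2"
      using M(2)[of "real j / H" "1 / H"] by (simp add: D_def add_divide_distrib diff_divide_distrib power_one_over)
    moreover have "norm (R j t) \<le> S / 2 * Q"
    proof -
      have "norm (R j t) \<le> S / 2 * ((\<Sum>m\<in>{t + j<..e}. (norm (\<mu> m))\<^sup>2) + (\<Sum>l\<in>{b<..b + 8 * L}. (norm (\<omega> l))\<^sup>2))" if "b \<le> t"
        unfolding R_def by (rule circle_method_bound) (use S in auto)
      moreover have "(\<Sum>m\<in>{t + j<..e}. (norm (\<mu> m))\<^sup>2) \<le> (\<Sum>m\<in>{b<..b + 8 * L}. (norm (\<mu> m))\<^sup>2)" if "b \<le> t"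
        using that by (intro sum_mono2) (auto simp: e_def)
      ultimately show ?thesis
      proof (cases "b \<le> t")
        case True
        have "S / 2 * ((\<Sum>m\<in>{t + j<..e}. (norm (\<mu> m))\<^sup>2) + (\<Sum>l\<in>{b<..b + 8 * L}. (norm (\<omega> l))\<^sup>2)) \<le> S / 2 * Q"
          unfolding Q_def using S0 True \<open>b \<le> t \<Longrightarrow> (\<Sum>m\<in>{t + j<..e}. (norm (\<mu> m))\<^sup>2) \<le> (\<Sum>m\<in>{b<..b + 8 * L}. (norm (\<mu> m))\<^sup>2)\<close>
          by (intro mult_left_mono add_right_mono) auto
        then show ?thesis using True \<open>b \<le> t \<Longrightarrow> norm (R j t) \<le> _\<close> by linarith
      next
        case False
        then have "{b..<b + L} \<inter> {..t} = {}" by auto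
        then have "R j t = 0" by (simp only: R_def sum.empty)
        then show ?thesis using S0 by (simp add: Q_def sum_nonneg)
      qed
    qed
    ultimately show "norm (of_real (D j) * R j t) \<le> (M / H\<^sup>2) * (S / 2 * Q)"
      unfolding norm_mult using M(1) by (intro mult_mono) auto
  qed
  also have "\<dots> = 8 * (real L)\<^sup>2 * (M / H\<^sup>2) * S * Q"
    by (simp add: e_def power2_eq_square)
  finally show ?thesis unfolding eq Q_def .
qed

text \<open>A window (a L, a L + k L] containing m has c - k < a <= c for c = (m - 1) div L, so m
  lies in at most k windows. Enlarging each block to length 8 L thus costs only a factor 8 in the
  mean squares.\<close>

lemma sum_overlapping_blocks_le:
  fixes g :: "nat \<Rightarrow> real"
  assumes g: "\<And>m. g m \<ge> 0" and L: "L > 0"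
  shows "(\<Sum>a<A. \<Sum>m\<in>{a * L<..a * L + k * L}. g m) \<le> real k * (\<Sum>m\<in>{0<..(A + k) * L}. g m)"
proof -
  have "(\<Sum>a<A. \<Sum>m\<in>{a * L<..a * L + k * L}. g m) =
      (\<Sum>a<A. \<Sum>m\<in>{0<..(A + k) * L}. if m \<in> {a * L<..a * L + k * L} then g m else 0)"
  proof (rule sum.cong[OF refl])
    fix a assume "a \<in> {..<A}"
    then have "a * L + k * L \<le> (A + k) * L" by (simp add: add_mult_distrib)
    then have "{0<..(A + k) * L} \<inter> {a * L<..a * L + k * L} = {a * L<..a * L + k * L}" by auto
    then show "(\<Sum>m\<in>{a * L<..a * L + k * L}. g m) =
        (\<Sum>m\<in>{0<..(A + k) * L}. if m \<in> {a * L<..a * L + k * L} then g m else 0)"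
      by (simp only: sum.inter_restrict[symmetric] finite_greaterThanAtMost)
  qed
  also have "\<dots> = (\<Sum>m\<in>{0<..(A + k) * L}. \<Sum>a<A. if m \<in> {a * L<..a * L + k * L} then g m else 0)"
    by (rule sum.swap)
  also have "\<dots> \<le> (\<Sum>m\<in>{0<..(A + k) * L}. real k * g m)"
  proof (rule sum_mono)
    fix m assume m: "m \<in> {0<..(A + k) * L}"
    define c where "c = (m - 1) div L"
    have "{a \<in> {..<A}. m \<in> {a * L<..a * L + k * L}} \<subseteq> {c + 1 - k..<c + 1}"
    proof
      fix a assume "a \<in> {a \<in> {..<A}. m \<in> {a * L<..a * L + k * L}}"
      then have a: "a * L \<le> m - 1" "m - 1 < (a + k) * L" using m by (auto simp: add_mult_distrib)
      have "a \<le> c" unfolding c_def using a(1) L by (simp add: less_eq_div_iff_mult_less_eq)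
      moreover have "c < a + k" unfolding c_def using a(2) L by (simp add: div_less_iff_less_mult)
      ultimately show "a \<in> {c + 1 - k..<c + 1}" by auto
    qed
    then have "card {a \<in> {..<A}. m \<in> {a * L<..a * L + k * L}} \<le> k"
      by (rule order_trans[OF card_mono[OF finite_atLeastLessThan]]) simp
    moreover have "(\<Sum>a<A. if m \<in> {a * L<..a * L + k * L} then g m else 0) =
        real (card {a \<in> {..<A}. m \<in> {a * L<..a * L + k * L}}) * g m"
      by (subst sum.inter_filter[symmetric]) simp_all
    ultimately show "(\<Sum>a<A. if m \<in> {a * L<..a * L + k * L} then g m else 0) \<le> real k * g m"
      using g[of m] by (simp add: mult_right_mono)
  qed
  finally show ?thesis by (simp add: sum_distrib_left)
qed

text \<open>Abel summation removes W(n/N), whose increments are O(1/N) over at most 2 N terms. The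
  cut at t is the condition n <= t from the weight separation; it leaves an interval of n, so the
  bound is uniform in t.\<close>

lemma weighted_twists_bound:
  assumes lam: "additive_twists_bounded lam" and W: "smooth_bump {1..2} W"
  shows "\<exists>C\<ge>0. \<forall>N\<ge>1. \<forall>b L t \<alpha>.
    norm (\<Sum>n\<in>{b..<b + L} \<inter> {..t}. (if 1 \<le> n \<and> real n \<le> 2 * N then lam n * of_real (W (real n / N)) else 0)
         * cis (2 * pi * (real n * \<alpha>))) \<le> C * (sqrt N * (2 + ln N))"
proof -
  obtain C where "\<forall>X\<ge>1. \<forall>M M' \<alpha>. M' \<le> X \<longrightarrow>
     norm (\<Sum>n\<in>{M<..M'}. lam n * cis (2 * pi * (real n * \<alpha>))) \<le> C * (sqrt (real X) * (1 + ln (real X)))"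
    using lam unfolding additive_twists_bounded_def by (rule exE)
  note C = this[rule_format]
  have C0: "C \<ge> 0" using order_trans[OF norm_ge_zero C[of 1 0 0]] by simp
  obtain M1 where M1: "M1 \<ge> 0" "\<forall>x. \<bar>W x\<bar> \<le> M1" using smooth_bump_bounded[OF W] by blast
  obtain M2 where M2: "M2 \<ge> 0" "\<forall>x y. \<bar>W x - W y\<bar> \<le> M2 * \<bar>x - y\<bar>" using smooth_bump_lipschitz[OF W] by blast
  define K where "K = C * 2 * (M1 + 2 * M2)"
  have K0: "K \<ge> 0" using C0 M1(1) M2(1) by (simp add: K_def)
  have "norm (\<Sum>n\<in>{b..<b + L} \<inter> {..t}. (if 1 \<le> n \<and> real n \<le> 2 * N then lam n * of_real (W (real n / N)) else 0)
         * cis (2 * pi * (real n * \<alpha>))) \<le> K * (sqrt N * (2 + ln N))"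
    if N: "N \<ge> 1" for N :: real and b L t \<alpha>
  proof -
    define X where "X = nat \<lfloor>2 * N\<rfloor>"
    have X: "real n \<le> 2 * N \<longleftrightarrow> n \<le> X" for n using N by (simp add: X_def le_nat_iff le_floor_iff)
    have X1: "1 \<le> X" using X[of 1] N by simp
    have X2: "real X \<le> 2 * N" using X[of X] by simp
    \<comment> \<open>The three constraints on n cut out the interval from max b 1 to M', written as
      half open on the left.\<close>
    define M where "M = max b 1 - 1"
    define M' where "M' = min (b + L - 1) (min t X)"
    have "(\<Sum>n\<in>{b..<b + L} \<inter> {..t}. (if 1 \<le> n \<and> real n \<le> 2 * N then lam n * of_real (W (real n / N)) else 0)
         * cis (2 * pi * (real n * \<alpha>))) = (\<Sum>n\<in>{M<..M'}. of_real (W (real n / N)) * (lam n * cis (2 * pi * (real n * \<alpha>))))"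
      unfolding X
    proof (rule sum.mono_neutral_cong_right)
      show "{M<..M'} \<subseteq> {b..<b + L} \<inter> {..t}" by (auto simp: M_def M'_def)
      show "\<forall>n\<in>{b..<b + L} \<inter> {..t} - {M<..M'}.
          (if 1 \<le> n \<and> n \<le> X then lam n * of_real (W (real n / N)) else 0) * cis (2 * pi * (real n * \<alpha>)) = 0"
      proof
        fix n assume "n \<in> {b..<b + L} \<inter> {..t} - {M<..M'}"
        then have "\<not> (1 \<le> n \<and> n \<le> X)" by (auto simp: M_def M'_def)
        then show "(if 1 \<le> n \<and> n \<le> X then lam n * of_real (W (real n / N)) else 0) * cis (2 * pi * (real n * \<alpha>)) = 0"
          by (simp only: if_False mult_zero_left)
      qed
      fix n assume "n \<in> {M<..M'}"
      then have "1 \<le> n \<and> n \<le> X" by (auto simp: M_def M'_def)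
      then show "(if 1 \<le> n \<and> n \<le> X then lam n * of_real (W (real n / N)) else 0) * cis (2 * pi * (real n * \<alpha>))
          = of_real (W (real n / N)) * (lam n * cis (2 * pi * (real n * \<alpha>)))"
        by (simp only: if_True simp_thms mult_ac)
    qed simp
    also have "norm \<dots> \<le> K * (sqrt N * (2 + ln N))"
    proof (cases "M < M'")
      case True
      have "norm (\<Sum>n\<in>{M<..M'}. of_real (W (real n / N)) * (lam n * cis (2 * pi * (real n * \<alpha>)))) \<le>
          C * (sqrt (real X) * (1 + ln (real X))) * (M1 + real (M' - M) * (M2 * (1 / N)))"
      proof (rule norm_sum_mult_le_abel[OF True])
        fix j assume "j \<le> M'"
        then show "norm (\<Sum>n\<in>{M<..j}. lam n * cis (2 * pi * (real n * \<alpha>))) \<le> C * (sqrt (real X) * (1 + ln (real X)))"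
          by (intro C X1) (simp add: M'_def)
      next
        show "norm (of_real (W (real M' / N)) :: complex) \<le> M1" using M1(2) by (simp only: norm_of_real)
      next
        fix n
        have "\<bar>W (real n / N) - W (real (Suc n) / N)\<bar> \<le> M2 * \<bar>real n / N - real (Suc n) / N\<bar>" by (rule M2(2)[rule_format])
        also have "\<bar>real n / N - real (Suc n) / N\<bar> = 1 / N" using N by (simp add: diff_divide_distrib[symmetric])
        finally show "norm (of_real (W (real n / N)) - of_real (W (real (Suc n) / N)) :: complex) \<le> M2 * (1 / N)"
          by (simp only: of_real_diff[symmetric] norm_of_real)
      qed (use M2(1) N in auto)
      also have "\<dots> \<le> C * (2 * (sqrt N * (2 + ln N))) * (M1 + 2 * M2)"
      proof (rule mult_mono)
        show "C * (sqrt (real X) * (1 + ln (real X))) \<le> C * (2 * (sqrt N * (2 + ln N)))"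
        proof (rule mult_left_mono[OF _ C0])
          have "sqrt (real X) \<le> sqrt (4 * N)" using X2 N by (intro real_sqrt_le_mono) simp
          then have "sqrt (real X) \<le> 2 * sqrt N" by (simp add: real_sqrt_mult)
          moreover have "ln (real X) \<le> ln (2 * N)" using X1 X2 by (intro ln_mono) auto
          then have "1 + ln (real X) \<le> 2 + ln N" using N ln_2_less_1 by (simp add: ln_mult)
          ultimately have "sqrt (real X) * (1 + ln (real X)) \<le> (2 * sqrt N) * (2 + ln N)"
            using X1 N by (intro mult_mono) auto
          then show "sqrt (real X) * (1 + ln (real X)) \<le> 2 * (sqrt N * (2 + ln N))" by simp
        qed
        have "real (M' - M) \<le> real X" by (simp add: M'_def)
        then have "real (M' - M) * (M2 * (1 / N)) \<le> (2 * N) * (M2 * (1 / N))"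
          using X2 M2(1) N by (intro mult_right_mono) auto
        then show "M1 + real (M' - M) * (M2 * (1 / N)) \<le> M1 + 2 * M2" using N by simp
      qed (use C0 M1(1) M2(1) N in auto)
      finally show ?thesis by (simp only: K_def mult_ac)
    next
      case False
      then show ?thesis using K0 N by simp
    qed
    finally show ?thesis .
  qed
  note main = this
  show ?thesis by (intro exI[of _ K] conjI K0 allI impI main)
qed

text \<open>Up to constants the blocks give N^(1/2) (2 + ln N) (N/H + 1). Both N/H and 1 are
  O(N^(1/2 - 2 \<delta>)), because 2 \<delta> <= \<epsilon> and 2 \<delta> <= 1/2 respectively; the
  logarithm then costs N^\<delta>, which explains the halving in \<delta>.\<close>

theorem triple_correlation_bound:
  fixes lam1 lam2 lam3 :: "nat \<Rightarrow> complex" and V W :: "real \<Rightarrow> real" and c \<epsilon> :: real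
  assumes eps: "\<epsilon> > 0" and c: "c > 0"
    and lam: "additive_twists_bounded lam1" "mean_square_bounded lam2" "mean_square_bounded lam3"
    and V: "smooth_bump {1..2} V" and W: "smooth_bump {1..2} W"
  defines "\<delta> \<equiv> min \<epsilon> (1 / 2) / 2"
  shows "\<exists>C::real. \<forall>N H :: real. N \<ge> 1 \<and> H \<ge> c * N powr (1 / 2 + \<epsilon>) \<longrightarrow>
         norm (1 / of_real H *
           (\<Sum>h | 1 \<le> h \<and> real h \<le> 2 * H. of_real (V (real h / H)) *
             (\<Sum>n | 1 \<le> n \<and> real n \<le> 2 * N.
                lam1 n * lam2 (n + h) * lam3 (n + 2 * h) * of_real (W (real n / N)))))
         \<le> C * N powr (1 - \<delta>)"
proof -
  obtain M where M: "M \<ge> 0" "\<forall>x s. \<bar>V (x + s) - 2 * V x + V (x - s)\<bar> \<le> M * s\<^sup>2"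
    using smooth_bump_second_difference[OF V] by blast
  obtain K where "K \<ge> 0 \<and> (\<forall>N\<ge>1. \<forall>b L t \<alpha>.
    norm (\<Sum>n\<in>{b..<b + L} \<inter> {..t}. (if 1 \<le> n \<and> real n \<le> 2 * N then lam1 n * of_real (W (real n / N)) else 0)
         * cis (2 * pi * (real n * \<alpha>))) \<le> K * (sqrt N * (2 + ln N)))"
    using weighted_twists_bound[OF lam(1) W] by (rule exE)
  note K = this[THEN conjunct1] this[THEN conjunct2, rule_format]
  obtain R2 where R2: "\<forall>X. (\<Sum>n\<in>{0<..X}. (norm (lam2 n))\<^sup>2) \<le> R2 * real X"
    using lam(2) by (auto simp: mean_square_bounded_def)
  obtain R3 where R3: "\<forall>X. (\<Sum>n\<in>{0<..X}. (norm (lam3 n))\<^sup>2) \<le> R3 * real X"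
    using lam(3) by (auto simp: mean_square_bounded_def)
  define R where "R = R2 + R3"
  have R0: "R \<ge> 0"
  proof -
    have "0 \<le> R2" using order_trans[OF sum_nonneg R2[rule_format, of 1]] by simp
    moreover have "0 \<le> R3" using order_trans[OF sum_nonneg R3[rule_format, of 1]] by simp
    ultimately show ?thesis by (simp add: R_def)
  qed
  have \<delta>: "\<delta> > 0" "2 * \<delta> \<le> \<epsilon>" "2 * \<delta> \<le> 1 / 2" using eps by (auto simp: \<delta>_def)
  \<comment> \<open>The block length is at most H + 1, and H >= c turns this into c' H; hence the
    factor L^2 / H^2 of each block is bounded.\<close>
  define c' where "c' = 1 + 1 / c"
  have c': "c' \<ge> 0" using c by (simp add: c'_def)
  \<comment> \<open>64 is the block constant 8 times the overlap 8. The windows reach up to X + 9 L,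
    whence 2 / c + 9 c' after division by H, and 2 + 1/\<delta> absorbs 2 + ln N into
    N^\<delta>.\<close>
  define C where "C = 64 * c'\<^sup>2 * M * K * R * (2 / c + 9 * c') * (2 + 1 / \<delta>)"
  have "norm (1 / of_real H *
           (\<Sum>h | 1 \<le> h \<and> real h \<le> 2 * H. of_real (V (real h / H)) *
             (\<Sum>n | 1 \<le> n \<and> real n \<le> 2 * N.
                lam1 n * lam2 (n + h) * lam3 (n + 2 * h) * of_real (W (real n / N)))))
         \<le> C * N powr (1 - \<delta>)" if N: "N \<ge> 1" and HN: "H \<ge> c * N powr (1 / 2 + \<epsilon>)" for N H :: real
  proof -
    have "1 \<le> N powr (1 / 2 + \<epsilon>)" using N eps by (intro ge_one_powr_ge_zero) auto
    then have Hc: "H \<ge> c" using HN mult_left_mono[of 1 "N powr (1 / 2 + \<epsilon>)" c] c by linarith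
    then have H: "H > 0" using c by linarith
    define L where "L = nat \<lceil>H\<rceil>"
    have L: "H \<le> real L" "L > 0" using H by (auto simp: L_def real_nat_ceiling_ge)
    have "real L \<le> H + 1" using H by (simp add: L_def)
    moreover have "1 \<le> H / c" using Hc c by simp
    ultimately have Lc: "real L \<le> c' * H" by (simp add: c'_def algebra_simps)
    define X where "X = nat \<lfloor>2 * N\<rfloor>"
    have X: "real n \<le> 2 * N \<longleftrightarrow> n \<le> X" for n using N by (simp add: X_def le_nat_iff le_floor_iff)
    have X2: "real X \<le> 2 * N" using X[of X] by simp
    \<comment> \<open>The blocks start at n = 0, where \<beta> vanishes, and cover all n <= X while
      overshooting by at most L.\<close>
    define A where "A = X div L + 1"
    have A: "X < A * L" "A * L \<le> X + L"
      using dividend_less_times_div[OF L(2), of X] times_div_less_eq_dividend[of L X]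
      by (simp_all add: A_def algebra_simps)
    define \<beta> where "\<beta> = (\<lambda>n. if 1 \<le> n \<and> real n \<le> 2 * N then lam1 n * of_real (W (real n / N)) else 0)"
    define S where "S = K * (sqrt N * (2 + ln N))"
    have S0: "S \<ge> 0" using K(1) N by (simp add: S_def)
    have Sb: "norm (\<Sum>n\<in>{b..<b + L} \<inter> {..t}. \<beta> n * cis (2 * pi * (real n * \<alpha>))) \<le> S" for b t \<alpha>
      unfolding \<beta>_def S_def by (rule K(2)[OF N])
    define f where "f = (\<lambda>n. \<Sum>h | 1 \<le> h \<and> real h \<le> 2 * H. of_real (V (real h / H)) * (\<beta> n * lam2 (n + h) * lam3 (n + 2 * h)))"
    define q where "q = (\<lambda>(mu :: nat \<Rightarrow> complex) a. \<Sum>m\<in>{a * L<..a * L + 8 * L}. (norm (mu m))\<^sup>2)"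
    let ?T = "\<Sum>h | 1 \<le> h \<and> real h \<le> 2 * H. of_real (V (real h / H)) *
             (\<Sum>n | 1 \<le> n \<and> real n \<le> 2 * N.
                lam1 n * lam2 (n + h) * lam3 (n + 2 * h) * of_real (W (real n / N)))"
    have inner: "(\<Sum>n | 1 \<le> n \<and> real n \<le> 2 * N. lam1 n * lam2 (n + h) * lam3 (n + 2 * h) * of_real (W (real n / N)))
        = (\<Sum>n<A * L. \<beta> n * lam2 (n + h) * lam3 (n + 2 * h))" for h
      by (rule sum.mono_neutral_cong_left) (use A(1) in \<open>auto simp: \<beta>_def X\<close>)
    have "?T = (\<Sum>h | 1 \<le> h \<and> real h \<le> 2 * H. \<Sum>n<A * L. of_real (V (real h / H)) * (\<beta> n * lam2 (n + h) * lam3 (n + 2 * h)))"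
      unfolding inner sum_distrib_left by (rule refl)
    also have "\<dots> = (\<Sum>n<A * L. f n)" unfolding f_def by (rule sum.swap)
    also have "\<dots> = (\<Sum>a<A. \<Sum>n\<in>{a * L..<a * L + L}. f n)" by (rule sum.nat_group[symmetric])
    also have "norm \<dots> \<le> (\<Sum>a<A. 8 * (real L)\<^sup>2 * (M / H\<^sup>2) * S * (q lam2 a + q lam3 a))"
    proof (rule sum_norm_le)
      fix a
      show "norm (\<Sum>n\<in>{a * L..<a * L + L}. f n) \<le> 8 * (real L)\<^sup>2 * (M / H\<^sup>2) * S * (q lam2 a + q lam3 a)"
        unfolding f_def q_def
        by (rule triple_correlation_block[OF V M(1) M(2)[rule_format] H L(1) Sb])
    qed
    also have "\<dots> = 8 * (real L)\<^sup>2 * (M / H\<^sup>2) * S * ((\<Sum>a<A. q lam2 a) + (\<Sum>a<A. q lam3 a))"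
      by (simp only: sum_distrib_left[symmetric] sum.distrib)
    also have "\<dots> \<le> 8 * (c' * H)\<^sup>2 * (M / H\<^sup>2) * S * (8 * (R * (2 * N + 9 * (c' * H))))"
    proof (intro mult_mono power_mono)
      have AL: "real ((A + 8) * L) \<le> 2 * N + 9 * (c' * H)"
      proof -
        have "real ((A + 8) * L) = real (A * L) + 8 * real L" by (simp add: algebra_simps)
        also have "real (A * L) \<le> real X + real L" using A(2) by (metis of_nat_add of_nat_mono)
        finally show ?thesis using X2 Lc by linarith
      qed
      have "(\<Sum>a<A. q mu a) \<le> real 8 * (\<Sum>m\<in>{0<..(A + 8) * L}. (norm (mu m))\<^sup>2)" for mu
        unfolding q_def by (rule sum_overlapping_blocks_le) (use L in auto)
      from add_mono[OF this[of lam2] this[of lam3]]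
      have "(\<Sum>a<A. q lam2 a) + (\<Sum>a<A. q lam3 a) \<le> 8 * (R * real ((A + 8) * L))"
        using R2[rule_format, of "(A + 8) * L"] R3[rule_format, of "(A + 8) * L"]
        by (simp add: R_def distrib_right)
      also have "\<dots> \<le> 8 * (R * (2 * N + 9 * (c' * H)))"
        using AL R0 by (intro mult_left_mono) auto
      finally show "(\<Sum>a<A. q lam2 a) + (\<Sum>a<A. q lam3 a) \<le> 8 * (R * (2 * N + 9 * (c' * H)))" .
      show "0 \<le> (\<Sum>a<A. q lam2 a) + (\<Sum>a<A. q lam3 a)"
        unfolding q_def by (intro add_nonneg_nonneg sum_nonneg) auto
    qed (use M(1) S0 H c' Lc in auto)
    also have "\<dots> = 64 * c'\<^sup>2 * M * S * R * (2 * N + 9 * (c' * H))"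
      using H by (simp add: power_mult_distrib)
    finally have T: "norm ?T \<le> 64 * c'\<^sup>2 * M * S * R * (2 * N + 9 * (c' * H))" .
    have "norm (1 / of_real H * ?T) = norm ?T / H" using H by (simp add: norm_mult norm_divide)
    also have "\<dots> \<le> 64 * c'\<^sup>2 * M * S * R * (2 * N + 9 * (c' * H)) / H"
      using T H by (intro divide_right_mono) auto
    also have "\<dots> = 64 * c'\<^sup>2 * M * R * (S * ((2 * N + 9 * (c' * H)) / H))"
      by simp
    also have "(2 * N + 9 * (c' * H)) / H = 2 * (N / H) + 9 * c'"
      using H by (simp add: add_divide_distrib)
    also have "64 * c'\<^sup>2 * M * R * (S * (2 * (N / H) + 9 * c')) \<le> 64 * c'\<^sup>2 * M * R * ((K * (N powr (1 / 2) * ((2 + 1 / \<delta>) * N powr \<delta>))) *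
        ((2 / c + 9 * c') * N powr (1 / 2 - 2 * \<delta>)))"
    proof (intro mult_left_mono mult_mono)
      show "S \<le> K * (N powr (1 / 2) * ((2 + 1 / \<delta>) * N powr \<delta>))"
        unfolding S_def powr_half_sqrt[OF order_trans[OF zero_le_one N]]
      proof (intro mult_left_mono)
        have "ln N \<le> N powr \<delta> / \<delta>" by (rule ln_powr_bound[OF N \<delta>(1)])
        moreover have "1 \<le> N powr \<delta>" using N \<delta> by (intro ge_one_powr_ge_zero) auto
        ultimately show "2 + ln N \<le> (2 + 1 / \<delta>) * N powr \<delta>" by (simp add: distrib_right)
      qed (use K(1) N in auto)
      have "N / H \<le> N / (c * N powr (1 / 2 + \<epsilon>))"
        using N HN c H by (intro divide_left_mono mult_pos_pos) auto
      also have "\<dots> = (1 / c) * (N powr 1 / N powr (1 / 2 + \<epsilon>))" using N by simp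
      also have "\<dots> = (1 / c) * N powr (1 / 2 - \<epsilon>)" by (simp only: powr_diff[symmetric]) simp
      also have "\<dots> \<le> (1 / c) * N powr (1 / 2 - 2 * \<delta>)"
        using N c \<delta> by (intro mult_left_mono powr_mono) auto
      finally have "N / H \<le> (1 / c) * N powr (1 / 2 - 2 * \<delta>)" .
      moreover have "9 * c' * 1 \<le> 9 * c' * N powr (1 / 2 - 2 * \<delta>)"
        using N c' \<delta> by (intro mult_left_mono ge_one_powr_ge_zero) auto
      ultimately show "2 * (N / H) + 9 * c' \<le> (2 / c + 9 * c') * N powr (1 / 2 - 2 * \<delta>)"
        by (simp add: distrib_right)
    qed (use M(1) R0 K(1) \<delta> N c' H c in auto)
    also have "\<dots> = C * (N powr (1 / 2) * N powr \<delta> * N powr (1 / 2 - 2 * \<delta>))"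
      by (simp add: C_def mult_ac)
    also have "N powr (1 / 2) * N powr \<delta> * N powr (1 / 2 - 2 * \<delta>) = N powr (1 - \<delta>)"
      by (simp only: powr_add[symmetric]) simp
    finally show ?thesis .
  qed
  note main = this
  show ?thesis by (intro exI[of _ C] allI impI, erule conjE) (rule main)
qed

section \<open>Primitive forms\<close>

text \<open>Writing ln u = ln (u/a) + ln a with a > |p| brings the slope of |p| ln u below 1. This
  encloses u^p between exp(-K - u) and exp(K + u) for either sign of p.\<close>

lemma abs_mult_ln_le:
  fixes p :: real
  shows "\<exists>K. \<forall>u\<ge>1 / 5. \<bar>p * ln u\<bar> \<le> K + u"
proof -
  define a where "a = \<bar>p\<bar> + 1"
  have a: "a > 0" "\<bar>p\<bar> \<le> a" by (auto simp: a_def)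
  have "\<bar>p * ln u\<bar> \<le> (\<bar>p\<bar> * \<bar>ln a\<bar> + 4 * \<bar>p\<bar>) + u" if u: "u \<ge> 1 / 5" for u
  proof -
    have "- ln u = ln (1 / u)" using u by (simp add: ln_div)
    also have "\<dots> \<le> 1 / u - 1" using u by (intro ln_le_minus_one) auto
    also have "\<dots> \<le> 4" using u by (simp add: field_simps)
    finally have 1: "- ln u \<le> 4" .
    have "ln u = ln (u / a) + ln a" using u a by (simp add: ln_div)
    also have "ln (u / a) \<le> u / a - 1" using u a by (intro ln_le_minus_one) auto
    finally have 2: "ln u \<le> u / a + \<bar>ln a\<bar>" by linarith
    have "0 \<le> u / a" using u a by simp
    with 1 2 have "\<bar>ln u\<bar> \<le> u / a + \<bar>ln a\<bar> + 4" by linarith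
    then have "\<bar>p\<bar> * \<bar>ln u\<bar> \<le> \<bar>p\<bar> * (u / a + \<bar>ln a\<bar> + 4)" by (rule mult_left_mono) simp
    also have "\<bar>p\<bar> * (u / a) \<le> a * (u / a)" using a u by (intro mult_right_mono) auto
    then have "\<bar>p\<bar> * (u / a + \<bar>ln a\<bar> + 4) \<le> \<bar>p\<bar> * \<bar>ln a\<bar> + 4 * \<bar>p\<bar> + u" using a by (simp add: algebra_simps)
    finally show ?thesis by (simp add: abs_mult)
  qed
  then show ?thesis by (intro exI[of _ "\<bar>p\<bar> * \<bar>ln a\<bar> + 4 * \<bar>p\<bar>"] allI impI)
qed

text \<open>The power contributes at most exp(K + u) or its inverse. With 5 <= 2 pi <= 8 the upper
  bound keeps a decay of at least exp(-u), and the lower bound has rate at most 9.\<close>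

lemma exponential_kernel_powr_exp:
  "exponential_kernel (\<lambda>u. of_real (u powr p * exp (- (2 * pi * u))))"
proof -
  obtain K where K: "\<forall>u\<ge>1 / 5. \<bar>p * ln u\<bar> \<le> K + u" using abs_mult_ln_le by blast
  have powr: "exp (- K - u) \<le> u powr p" "u powr p \<le> exp (K + u)" if "u \<ge> 1 / 5" for u
  proof -
    have "\<bar>p * ln u\<bar> \<le> K + u" using K that by blast
    then show "exp (- K - u) \<le> u powr p" "u powr p \<le> exp (K + u)" using that by (auto simp: powr_def)
  qed
  have pi: "5 * u \<le> 2 * pi * u" "2 * pi * u \<le> 8 * u" if "u \<ge> 1 / 5" for u
    using that pi_gt3 pi_less_4 by (intro mult_right_mono; simp)+
  show ?thesis
    unfolding exponential_kernel_def
  proof (intro conjI allI impI)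
    show "\<exists>C. \<forall>u\<ge>1 / 5. norm (complex_of_real (u powr p * exp (- (2 * pi * u)))) \<le> C * exp (- u)"
    proof (intro exI[of _ "exp K"] allI impI)
      fix u :: real assume u: "u \<ge> 1 / 5"
      have "u powr p * exp (- (2 * pi * u)) \<le> exp (K + u) * exp (- (2 * pi * u))"
        by (intro mult_right_mono powr u) simp
      also have "\<dots> = exp (K + u - 2 * pi * u)" by (simp add: exp_add[symmetric])
      also have "\<dots> \<le> exp (K - u)" using pi(1)[OF u] u by simp
      also have "\<dots> = exp K * exp (- u)" by (simp add: exp_add[symmetric])
      finally show "norm (complex_of_real (u powr p * exp (- (2 * pi * u)))) \<le> exp K * exp (- u)"
        by (simp only: norm_of_real abs_of_nonneg mult_nonneg_nonneg powr_ge_zero exp_ge_zero)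
    qed
    show "\<exists>a>0. \<exists>c>0. \<forall>u\<ge>a. c * exp (- (20 * u)) \<le> norm (complex_of_real (u powr p * exp (- (2 * pi * u))))"
    proof (rule exI[of _ 1], rule conjI[OF zero_less_one], rule exI[of _ "exp (- K)"], intro conjI allI impI)
      fix u :: real assume "u \<ge> 1"
      then have u: "u \<ge> 1 / 5" by simp
      have "exp (- K) * exp (- (20 * u)) = exp (- K - 20 * u)" by (simp add: exp_add[symmetric])
      also have "\<dots> \<le> exp (- K - u + - (2 * pi * u))" using pi(2)[OF u] u by simp
      also have "\<dots> = exp (- K - u) * exp (- (2 * pi * u))" by (simp only: exp_add)
      also have "\<dots> \<le> u powr p * exp (- (2 * pi * u))" by (intro mult_right_mono powr u) simp
      finally show "exp (- K) * exp (- (20 * u)) \<le> norm (complex_of_real (u powr p * exp (- (2 * pi * u))))"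
        by (simp only: norm_of_real abs_of_nonneg mult_nonneg_nonneg powr_ge_zero exp_ge_zero)
    qed simp_all
    fix a :: real assume a: "a > 0"
    define g where "g = (\<lambda>u. u powr p * exp (- (2 * pi * u)))"
    define g' where "g' = (\<lambda>u. p * u powr (p - 1) * exp (- (2 * pi * u)) - 2 * pi * (u powr p * exp (- (2 * pi * u))))"
    have der: "(g has_field_derivative g' u) (at u within {a..3 * a})" if "u \<in> {a..3 * a}" for u
      unfolding g_def g'_def using that a by (auto intro!: derivative_eq_intros)
    have "continuous_on {a..3 * a} g'"
      unfolding g'_def using a by (auto intro!: continuous_intros)
    then have "bounded (g' ` {a..3 * a})" by (intro compact_imp_bounded compact_continuous_image) auto
    then obtain D where D: "\<forall>u\<in>{a..3 * a}. \<bar>g' u\<bar> \<le> D" by (auto simp: bounded_iff)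
    have D0: "D \<ge> 0" using D[rule_format, of a] a by simp
    show "\<exists>\<Lambda>\<ge>0. \<forall>u\<in>{a..3 * a}. \<forall>v\<in>{a..3 * a}.
        norm (complex_of_real (u powr p * exp (- (2 * pi * u))) - complex_of_real (v powr p * exp (- (2 * pi * v)))) \<le> \<Lambda> * \<bar>u - v\<bar>"
    proof (intro exI[of _ D] conjI D0 ballI)
      fix u v assume uv: "u \<in> {a..3 * a}" "v \<in> {a..3 * a}"
      have "norm (g u - g v) \<le> D * norm (u - v)"
        by (rule field_differentiable_bound[of "{a..3 * a}" g g' D u v]) (use der D uv in auto)
      then show "norm (complex_of_real (u powr p * exp (- (2 * pi * u))) - complex_of_real (v powr p * exp (- (2 * pi * v)))) \<le> D * \<bar>u - v\<bar>"
        by (simp only: of_real_diff[symmetric] norm_of_real g_def real_norm_def)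
    qed
  qed
qed

lemma fourier_e_eq: "fourier_e (of_nat n * Complex x y) = of_real (exp (- (2 * pi * (real n * y)))) * cis (2 * pi * (real n * x))"
  unfolding fourier_e_def exp_eq_polar by (simp add: mult_ac)

text \<open>Multiplying by y^(k/2) = sqrt y * y^((k-1)/2) merges n^((k-1)/2) and y^((k-1)/2) into (n
  y)^((k-1)/2), so the kernel depends on n y alone.\<close>

lemma primitive_holomorphic_form_bounds:
  assumes "primitive_holomorphic_form k f lam"
  shows "additive_twists_bounded lam \<and> mean_square_bounded lam"
proof -
  define p where "p = (real_of_int k - 1) / 2"
  define \<kappa> where "\<kappa> = (\<lambda>u. complex_of_real (u powr p * exp (- (2 * pi * u))))"
  define \<rho> where "\<rho> = (\<lambda>n. lam (nat n))"
  have mod: "modular_of_weight k f" and coeffs: "holomorphic_coeffs k f lam"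
    using assms by (auto simp: primitive_holomorphic_form_def holomorphic_cusp_form_def)
  have "((\<lambda>n. of_real (sqrt y) * \<rho> n * \<kappa> (\<bar>of_int n\<bar> * y) * cis (2 * pi * (of_int n * x))) has_sum
        (of_real (y powr (real_of_int k / 2)) * f (Complex x y))) {1..}" if y: "y > 0" for x y
  proof -
    have "Complex x y \<in> upper_half_plane" using y by (simp add: upper_half_plane_def)
    then have "((\<lambda>n. lam n * of_real (real n powr p) * fourier_e (of_nat n * Complex x y)) has_sum f (Complex x y)) {1..}"
      using coeffs unfolding holomorphic_coeffs_def p_def by blast
    then have "((\<lambda>n. of_real (y powr (real_of_int k / 2)) * (lam n * of_real (real n powr p) * fourier_e (of_nat n * Complex x y)))
        has_sum (of_real (y powr (real_of_int k / 2)) * f (Complex x y))) {1..}"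
      by (rule has_sum_cmult_right)
    moreover have "((\<lambda>n. of_real (y powr (real_of_int k / 2)) * (lam n * of_real (real n powr p) * fourier_e (of_nat n * Complex x y)))
        has_sum (of_real (y powr (real_of_int k / 2)) * f (Complex x y))) {1..} \<longleftrightarrow>
       ((\<lambda>n. of_real (sqrt y) * \<rho> n * \<kappa> (\<bar>of_int n\<bar> * y) * cis (2 * pi * (of_int n * x))) has_sum
        (of_real (y powr (real_of_int k / 2)) * f (Complex x y))) {1..}"
    proof (rule has_sum_reindex_bij_witness[of _ nat int])
      fix n :: nat assume n: "n \<in> {1..}"
      have "y powr (real_of_int k / 2) = y powr (1 / 2 + p)" by (simp add: p_def field_simps)
      also have "\<dots> = sqrt y * y powr p" using y by (simp add: powr_add powr_half_sqrt)
      finally have yk: "y powr (real_of_int k / 2) = sqrt y * y powr p" .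
      have ny: "(real n * y) powr p = real n powr p * y powr p" using n y by (simp add: powr_mult)
      show "of_real (sqrt y) * \<rho> (int n) * \<kappa> (\<bar>of_int (int n)\<bar> * y) * cis (2 * pi * (of_int (int n) * x)) =
         of_real (y powr (real_of_int k / 2)) * (lam n * of_real (real n powr p) * fourier_e (of_nat n * Complex x y))"
        unfolding fourier_e_eq yk \<kappa>_def \<rho>_def by (simp add: ny)
    qed auto
    ultimately show ?thesis by blast
  qed
  note expansion = this
  have "additive_twists_bounded (\<lambda>n. \<rho> (int n)) \<and> mean_square_bounded (\<lambda>n. \<rho> (int n))"
  proof (rule modular_expansion_bounds[OF mod expansion])
    show "exponential_kernel \<kappa>" unfolding \<kappa>_def by (rule exponential_kernel_powr_exp)
  qed auto
  then show ?thesis by (simp add: \<rho>_def)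
qed

lemma primitive_maass_form_bounds:
  assumes "primitive_maass_form \<nu> f \<rho>"
  shows "additive_twists_bounded (\<lambda>n. \<rho> (int n)) \<and> mean_square_bounded (\<lambda>n. \<rho> (int n))"
proof -
  have mod: "modular_of_weight 0 f" and coeffs: "maass_coeffs \<nu> f \<rho>"
    using assms by (auto simp: primitive_maass_form_def maass_cusp_form_def)
  have fe: "fourier_e (of_int n * of_real x) = cis (2 * pi * (of_int n * x))" for n x
    by (simp add: fourier_e_def cis_conv_exp mult_ac)
  have "((\<lambda>n. of_real (sqrt y) * \<rho> n * bessel_K (\<i> * \<nu>) (2 * pi * (\<bar>of_int n\<bar> * y)) * cis (2 * pi * (of_int n * x))) has_sum
        (of_real (y powr (real_of_int 0 / 2)) * f (Complex x y))) (UNIV - {0})" if y: "y > 0" for x y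
    using coeffs[unfolded maass_coeffs_def, rule_format, OF y, of x] y by (simp add: fe mult.assoc)
  note expansion = this
  show ?thesis
    by (rule modular_expansion_bounds[OF mod expansion _ _ exponential_kernel_bessel_K]) auto
qed

lemma primitive_form_coeffs_bounds:
  assumes "primitive_form_coeffs f lam"
  shows "additive_twists_bounded lam" "mean_square_bounded lam"
proof -
  have "additive_twists_bounded lam \<and> mean_square_bounded lam"
    using assms unfolding primitive_form_coeffs_def
  proof (elim disjE exE conjE)
    fix k assume "primitive_holomorphic_form k f lam"
    then show ?thesis by (rule primitive_holomorphic_form_bounds)
  next
    fix \<nu> \<rho> assume f: "primitive_maass_form \<nu> f \<rho>" and eq: "\<forall>n\<ge>1. lam n = \<rho> (int n)"
    show ?thesis
      using primitive_maass_form_bounds[OF f] additive_twists_bounded_cong[of lam "\<lambda>n. \<rho> (int n)"]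
        mean_square_bounded_cong[of lam "\<lambda>n. \<rho> (int n)"] eq by blast
  qed
  then show "additive_twists_bounded lam" "mean_square_bounded lam" by auto
qed

theorem theorem1p1:
  fixes \<epsilon> :: real
  assumes "\<epsilon> > 0"
  shows "\<exists>\<delta>::real. \<delta> > 0 \<and>
    (\<forall>(f1 :: complex \<Rightarrow> complex) (f2 :: complex \<Rightarrow> complex) (f3 :: complex \<Rightarrow> complex)
      (lam1 :: nat \<Rightarrow> complex) (lam2 :: nat \<Rightarrow> complex) (lam3 :: nat \<Rightarrow> complex)
      (V :: real \<Rightarrow> real) (W :: real \<Rightarrow> real) (c :: real).
      primitive_form_coeffs f1 lam1 \<and> primitive_form_coeffs f2 lam2 \<and>
      primitive_form_coeffs f3 lam3 \<and>
      smooth_bump {1..2} V \<and> smooth_bump {1..2} W \<and> c > 0 \<longrightarrow>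
      (\<exists>C::real. \<forall>N H :: real. N \<ge> 1 \<and> H \<ge> c * N powr (1 / 2 + \<epsilon>) \<longrightarrow>
         norm (1 / of_real H *
           (\<Sum>h | 1 \<le> h \<and> real h \<le> 2 * H. of_real (V (real h / H)) *
             (\<Sum>n | 1 \<le> n \<and> real n \<le> 2 * N.
                lam1 n * lam2 (n + h) * lam3 (n + 2 * h) * of_real (W (real n / N)))))
         \<le> C * N powr (1 - \<delta>)))"
proof (rule exI[of _ "min \<epsilon> (1 / 2) / 2"], intro conjI allI impI, goal_cases)
  case 1
  then show ?case using assms by simp
next
  case (2 f1 f2 f3 lam1 lam2 lam3 V W c)
  then have forms: "primitive_form_coeffs f1 lam1" "primitive_form_coeffs f2 lam2" "primitive_form_coeffs f3 lam3"
    and V: "smooth_bump {1..2} V" and W: "smooth_bump {1..2} W" and c: "c > 0" by blast+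
  \<comment> \<open>The first form supplies the bound for additive twists, the other two their mean
    squares. The exponent depends on \<epsilon> only, the constant on everything else.\<close>
  show ?case
    by (rule triple_correlation_bound[OF assms c primitive_form_coeffs_bounds(1)[OF forms(1)]
          primitive_form_coeffs_bounds(2)[OF forms(2)] primitive_form_coeffs_bounds(2)[OF forms(3)] V W])
qed

end
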